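(* If $G$ is a subcubic outerplanar graph with no triangles, then $G$ is $(1,2,2,2)$-packing colorable.
   Context: All graphs are finite and simple. A graph is subcubic if every vertex has degree at most $3$, and outerplanar if it has a planar drawing in which all vertices lie on the outer face. For a positive integer $d$, a set $A\subseteq V(G)$ is a $d$-packing if any two distinct vertices of $A$ are at distance greater than $d$ in $G$. For a nondecreasing sequence $S=(s_1,\ldots,s_m)$ of positive integers, an $S$-packing coloring of $G$ is a map $c:V(G)\to\{1,\ldots,m\}$ such that for every $i$, the set $c^{-1}(i)$ is an $s_i$-packing; $G$ is $S$-packing colorable if such a map exists. Thus a $(1,2,2,2)$-packing coloring uses four color classes: one independent set and three sets whose vertices are pairwise at distance greater than $2$. *)

theory Defs
  imports "HOL-Analysis.Analysis" "Graph_Theory.Pair_Digraph" "Graph_Theory.Shortest_Path"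
begin

text \<open>
  A finite simple graph is an instance of the locale \<open>pair_graph\<close>: a finite, symmetric, loopfree
  set of arcs without parallel arcs, so that each undirected edge is present as two opposite arcs.
\<close>

definition edges_of :: "'a pair_pre_digraph \<Rightarrow> 'a set set" where
  "edges_of G = {{u, v} | u v. (u, v) \<in> parcs G}"

definition subcubic :: "'a pair_pre_digraph \<Rightarrow> bool" where
  "subcubic G \<longleftrightarrow> (\<forall>v \<in> pverts G. out_degree (with_proj G) v \<le> 3)"

text \<open>Loopfreeness makes the three vertices below distinct.\<close>

definition triangle_free :: "'a pair_pre_digraph \<Rightarrow> bool" where
  "triangle_free G \<longleftrightarrow>
     \<not> (\<exists>u v w. (u, v) \<in> parcs G \<and> (v, w) \<in> parcs G \<and> (w, u) \<in> parcs G)"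

text \<open>
  In a drawing the edges are arbitrary (not necessarily straight) Jordan arcs. Each arc meets the
  vertex points in its two ends only, and distinct arcs meet in the points of common ends only.
\<close>

definition planar_drawing ::
    "'a pair_pre_digraph \<Rightarrow> ('a \<Rightarrow> complex) \<Rightarrow> ('a set \<Rightarrow> real \<Rightarrow> complex) \<Rightarrow> bool" where
  "planar_drawing G pt curve \<longleftrightarrow>
     inj_on pt (pverts G) \<and>
     (\<forall>e \<in> edges_of G.
        arc (curve e) \<and>
        {pathstart (curve e), pathfinish (curve e)} = pt ` e \<and>
        path_image (curve e) \<inter> pt ` pverts G = pt ` e) \<and>
     (\<forall>e \<in> edges_of G. \<forall>f \<in> edges_of G. e \<noteq> f \<longrightarrow>
        path_image (curve e) \<inter> path_image (curve f) = pt ` (e \<inter> f))"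

definition drawing_points ::
    "'a pair_pre_digraph \<Rightarrow> ('a \<Rightarrow> complex) \<Rightarrow> ('a set \<Rightarrow> real \<Rightarrow> complex) \<Rightarrow> complex set" where
  "drawing_points G pt curve = pt ` pverts G \<union> (\<Union>e \<in> edges_of G. path_image (curve e))"

text \<open>
  The drawing of a finite graph is compact, so \<open>outside\<close> of it is the unique unbounded component
  of its complement, i.e. the outer face. Faces are open, hence a vertex lies on a face
  iff it belongs to the frontier of that face.
\<close>

definition outerplanar :: "'a pair_pre_digraph \<Rightarrow> bool" where
  "outerplanar G \<longleftrightarrow>
     (\<exists>pt curve. planar_drawing G pt curve \<and>
        pt ` pverts G \<subseteq> frontier (outside (drawing_points G pt curve)))"

text \<open>With unit weights, \<open>\<mu>\<close> is the graph distance (\<open>\<infinity>\<close> between different components).\<close>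

definition graph_dist :: "'a pair_pre_digraph \<Rightarrow> 'a \<Rightarrow> 'a \<Rightarrow> ereal" where
  "graph_dist G u v = wf_digraph.\<mu> (with_proj G) (\<lambda>_. 1) u v"

definition is_packing :: "'a pair_pre_digraph \<Rightarrow> nat \<Rightarrow> 'a set \<Rightarrow> bool" where
  "is_packing G d A \<longleftrightarrow>
     A \<subseteq> pverts G \<and> (\<forall>u \<in> A. \<forall>v \<in> A. u \<noteq> v \<longrightarrow> ereal (real d) < graph_dist G u v)"

text \<open>Colors are \<open>0, \<dots>, length S - 1\<close> rather than \<open>1, \<dots>, length S\<close>.\<close>

definition packing_coloring :: "'a pair_pre_digraph \<Rightarrow> nat list \<Rightarrow> ('a \<Rightarrow> nat) \<Rightarrow> bool" where
  "packing_coloring G S c \<longleftrightarrow>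
     (\<forall>v \<in> pverts G. c v < length S) \<and>
     (\<forall>i < length S. is_packing G (S ! i) {v \<in> pverts G. c v = i})"

definition packing_colorable :: "'a pair_pre_digraph \<Rightarrow> nat list \<Rightarrow> bool" where
  "packing_colorable G S \<longleftrightarrow> (\<exists>c. packing_coloring G S c)"

end

theory Submission
  imports Defs
begin

text \<open>
  The only consequence of outerplanarity that is used: there are no three internally disjoint paths,
  each with an inner vertex, between two vertices \<open>a\<close> and \<open>b\<close>. Three such paths would be drawn as a
  theta curve with a vertex inside each arc, and all of these would have to lie on the outer face.

  The colouring is found by induction over induced subgraphs, for the stronger claim that any chosen
  vertex of degree at most \<open>2\<close> can be kept out of the independent class. A cut with at most one edge
  reduces to its two sides: after recolouring saturated ends of the edge, a permutation of the three
  packing colours makes the two colourings fit. Otherwise a longest cycle is Hamiltonian and its chords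
  do not cross, so a shortest chord \<open>ab\<close> cuts off a path of vertices of degree \<open>2\<close>; its inner vertices
  are deleted, and the colouring of the rest extends to them.
\<close>

section \<open>Theta curves on the outer face\<close>

text \<open>The four colours are not interchangeable: \<open>0\<close> has a weaker condition, so
  only \<open>1\<close>, \<open>2\<close>, \<open>3\<close> may be permuted, and no permutation
  separates two ends of a cut edge that both have colour \<open>0\<close>. This is why a root is
  carried along. The end of the cut edge on the side without the original root has lost a neighbour,
  so it has degree at most \<open>2\<close> there, and rooting that side at it makes its colour
  nonzero. Recolouring with \<open>0\<close> is the operation that frees packing colours. It is
  applied only to a vertex with two nonzero neighbours on its own side. With its neighbour across
  the cut, or on the ear, that vertex has degree \<open>3\<close>, so if it is the root, nothing is
  demanded of it any more. The forbidden configuration is a subdivision of \<open>K_{2,3}\<close>. A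
  subdivision of \<open>K_4\<close> without triangles contains one, so a single topological fact
  suffices. The absence of triangles also gives at least two inner vertices on the path cut off by a
  shortest chord, the length from which the colour patterns start.\<close>

lemma inside_two_arcs:
  fixes c d :: "real \<Rightarrow> complex"
  assumes "arc c" "arc d" "pathstart c = a" "pathfinish c = b" "pathstart d = a" "pathfinish d = b"
    and "path_image c \<inter> path_image d = {a, b}"
  defines "C \<equiv> path_image c \<union> path_image d"
  shows "inside C \<noteq> {}" "open (inside C)" "connected (inside C)" "connected (outside C)"
    "frontier (inside C) = C"
proof -
  \<comment> \<open>The two arcs form a simple closed curve, to which the Jordan curve theorem
    applies.\<close>
  have "simple_path (c +++ reversepath d)"
    by (rule simple_path_join_loop) (use assms in \<open>auto simp: arc_reversepath\<close>)
  moreover have "path_image (c +++ reversepath d) = C"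
    using assms by (simp add: path_image_join)
  ultimately show "inside C \<noteq> {}" "open (inside C)" "connected (inside C)" "connected (outside C)"
    "frontier (inside C) = C"
    using Jordan_inside_outside[of "c +++ reversepath d"] assms by auto
qed

text \<open>\<open>outside D\<close> lies in \<open>outside S\<close>, which misses the open set
  \<open>inside S\<close>; an open set that misses a set also misses its closure. Hence no point on
  the outer face lies strictly inside a cycle of the drawing.\<close>

lemma inside_disjoint_outer_frontier:
  fixes S D :: "complex set"
  assumes "S \<subseteq> D" "open (inside S)"
  shows "inside S \<inter> frontier (outside D) = {}"
proof -
  have "inside S \<inter> outside D = {}"
    using outside_mono[OF \<open>S \<subseteq> D\<close>] inside_Int_outside[of S] by blast
  then show ?thesis
    using open_Int_closure_eq_empty[OF assms(2)] by (auto simp: frontier_def)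
qed

text \<open>
  Each arc has a point on the outer face, so none of them enters the inside of the cycle formed by
  the two others. The three insides are then pairwise disjoint, and Janiszewski's theorem for
  \<open>c1 \<union> c3\<close> and \<open>c2 \<union> c3\<close> joins the inside of \<open>c1 \<union> c2\<close> to its outside.
\<close>
lemma no_theta_curve_on_outer_face:
  fixes c1 c2 c3 :: "real \<Rightarrow> complex"
  assumes arcs: "arc c1" "arc c2" "arc c3"
    and start: "pathstart c1 = a" "pathstart c2 = a" "pathstart c3 = a"
    and fin: "pathfinish c1 = b" "pathfinish c2 = b" "pathfinish c3 = b"
    and disj: "path_image c1 \<inter> path_image c2 = {a, b}" "path_image c1 \<inter> path_image c3 = {a, b}"
      "path_image c2 \<inter> path_image c3 = {a, b}"
    and sub: "path_image c1 \<subseteq> D" "path_image c2 \<subseteq> D" "path_image c3 \<subseteq> D"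
    and outer: "q1 \<in> path_image c1 - {a, b}" "q1 \<in> frontier (outside D)"
      "q2 \<in> path_image c2 - {a, b}" "q2 \<in> frontier (outside D)"
      "q3 \<in> path_image c3 - {a, b}" "q3 \<in> frontier (outside D)"
  shows False
proof -
  let ?A = "path_image c1" and ?B = "path_image c2" and ?C = "path_image c3"
  note AB = inside_two_arcs[OF arcs(1,2) start(1) fin(1) start(2) fin(2) disj(1)]
  note AC = inside_two_arcs[OF arcs(1,3) start(1) fin(1) start(3) fin(3) disj(2)]
  note BC = inside_two_arcs[OF arcs(2,3) start(2) fin(2) start(3) fin(3) disj(3)]
  \<comment> \<open>Without its ends the arc \<open>c\<close> is connected and misses
    \<open>S\<close>, so it lies on one side of \<open>S\<close>; the point \<open>q\<close>
    excludes the inside.\<close>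
  have avoid: "inside S \<inter> path_image c = {}"
    if oi: "open (inside S)" and SD: "S \<subseteq> D"
      and c: "arc c" "pathstart c = a" "pathfinish c = b" and cS: "path_image c \<inter> S = {a, b}"
      and q: "q \<in> path_image c - {a, b}" "q \<in> frontier (outside D)" and S: "closed S"
    for S c q
  proof -
    have con: "connected (path_image c - {a, b})"
      using connected_simple_path_endless[OF arc_imp_simple_path[OF c(1)]] c by simp
    have notS: "path_image c - {a, b} \<subseteq> inside S \<union> outside S"
      unfolding inside_Un_outside using cS by blast
    have "q \<notin> inside S"
      using inside_disjoint_outer_frontier[OF SD oi] q(2) by blast
    then have "outside S \<inter> (path_image c - {a, b}) \<noteq> {}"
      using notS q(1) by blast
    moreover have "inside S \<inter> outside S \<inter> (path_image c - {a, b}) = {}"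
      by (simp add: inside_Int_outside)
    ultimately have "inside S \<inter> (path_image c - {a, b}) = {}"
      using connectedD[OF con oi open_outside[OF S] _ notS] by blast
    moreover have "a \<notin> inside S" "b \<notin> inside S"
      using cS inside_no_overlap[of S] by blast+
    ultimately show ?thesis by blast
  qed
  have closed: "closed ?A" "closed ?B" "closed ?C"
    using arcs by (auto intro: closed_arc_image)
  have subs: "?A \<union> ?B \<subseteq> D" "?A \<union> ?C \<subseteq> D" "?B \<union> ?C \<subseteq> D"
    using sub by auto
  have meets: "?C \<inter> (?A \<union> ?B) = {a, b}" "?B \<inter> (?A \<union> ?C) = {a, b}" "?A \<inter> (?B \<union> ?C) = {a, b}"
    using disj by blast+
  have iAB: "inside (?A \<union> ?B) \<inter> ?C = {}"
    using avoid[OF AB(2) subs(1) arcs(3) start(3) fin(3) meets(1) outer(5,6)] closed by blast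
  have iAC: "inside (?A \<union> ?C) \<inter> ?B = {}"
    using avoid[OF AC(2) subs(2) arcs(2) start(2) fin(2) meets(2) outer(3,4)] closed by blast
  have iBC: "inside (?B \<union> ?C) \<inter> ?A = {}"
    using avoid[OF BC(2) subs(3) arcs(1) start(1) fin(1) meets(3) outer(1,2)] closed by blast
  \<comment> \<open>Neither inside meets the other curve, so overlapping insides would coincide, and
    then so would their frontiers \<open>S\<close> and \<open>T\<close>.\<close>
  have side: "inside S \<subseteq> outside T"
    if ST: "inside S \<inter> T = {}" and TS: "inside T \<inter> S = {}" and ne: "S \<noteq> T" and cl: "closed S" "closed T"
      and op: "open (inside S)" "open (inside T)" and con: "connected (inside S)" "connected (inside T)"
      and fr: "frontier (inside S) = S" "frontier (inside T) = T"
    for S T :: "complex set"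
  proof (rule ccontr)
    assume neg: "\<not> inside S \<subseteq> outside T"
    have coverS: "inside S \<subseteq> inside T \<union> outside T" and coverT: "inside T \<subseteq> inside S \<union> outside S"
      unfolding inside_Un_outside using ST TS by blast+
    have meet: "inside S \<inter> inside T \<noteq> {}" using neg coverS by blast
    have "outside T \<inter> inside S = {}"
      using connectedD[OF con(1) op(2) open_outside[OF cl(2)] _ coverS] meet inside_Int_outside[of T]
      by blast
    moreover have "outside S \<inter> inside T = {}"
      using connectedD[OF con(2) op(1) open_outside[OF cl(1)] _ coverT] meet inside_Int_outside[of S]
      by blast
    ultimately have "inside S = inside T" using coverS coverT by blast
    then show False using fr ne by simp
  qed
  have "inside (?A \<union> ?B) \<subseteq> outside (?A \<union> ?C)"
  proof (rule side[OF _ _ _ _ _ AB(2) AC(2) AB(3) AC(3) AB(5) AC(5)])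
    show "inside (?A \<union> ?B) \<inter> (?A \<union> ?C) = {}" using iAB inside_no_overlap by blast
    show "inside (?A \<union> ?C) \<inter> (?A \<union> ?B) = {}" using iAC inside_no_overlap by blast
    show "?A \<union> ?B \<noteq> ?A \<union> ?C" using outer disj by blast
  qed (use closed in blast)+
  moreover have "inside (?A \<union> ?B) \<subseteq> outside (?B \<union> ?C)"
  proof (rule side[OF _ _ _ _ _ AB(2) BC(2) AB(3) BC(3) AB(5) BC(5)])
    show "inside (?A \<union> ?B) \<inter> (?B \<union> ?C) = {}" using iAB inside_no_overlap by blast
    show "inside (?B \<union> ?C) \<inter> (?A \<union> ?B) = {}" using iBC inside_no_overlap by blast
    show "?A \<union> ?B \<noteq> ?B \<union> ?C" using outer disj by blast
  qed (use closed in blast)+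
  moreover obtain x where x: "x \<in> inside (?A \<union> ?B)" using AB(1) by blast
  have "bounded (?A \<union> ?B \<union> ?C)"
    using arcs by (simp add: bounded_arc_image)
  then have "outside (?A \<union> ?B \<union> ?C) \<noteq> {}"
    using outside_bounded_nonempty by blast
  then obtain y where y: "y \<in> outside (?A \<union> ?B \<union> ?C)" by blast
  have yo: "y \<in> outside (?A \<union> ?B)" "y \<in> outside (?A \<union> ?C)" "y \<in> outside (?B \<union> ?C)"
    using y outside_mono[of "?A \<union> ?B" "?A \<union> ?B \<union> ?C"] outside_mono[of "?A \<union> ?C" "?A \<union> ?B \<union> ?C"]
      outside_mono[of "?B \<union> ?C" "?A \<union> ?B \<union> ?C"] by blast+
  ultimately have xo: "x \<in> outside (?A \<union> ?C)" "x \<in> outside (?B \<union> ?C)"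
    using x by blast+
  \<comment> \<open>The two obstacles share exactly the third arc, which is connected, so points
    separated by neither are not separated by their union. Yet \<open>?A \<union> ?B\<close>, a part
    of this union, has \<open>x\<close> inside and \<open>y\<close> outside.\<close>
  have "connected_component (- ((?A \<union> ?C) \<union> (?B \<union> ?C))) x y"
  proof (rule Janiszewski)
    show "compact (?A \<union> ?C)" using arcs by (simp add: compact_Un compact_arc_image)
    show "closed (?B \<union> ?C)" using closed by blast
    have "(?A \<union> ?C) \<inter> (?B \<union> ?C) = ?C"
      using disj by blast
    then show "connected ((?A \<union> ?C) \<inter> (?B \<union> ?C))"
      using arcs by (simp add: connected_arc_image)
    show "connected_component (- (?A \<union> ?C)) x y"
      unfolding connected_component_def using xo(1) yo(2) AC(4) outside_no_overlap[of "?A \<union> ?C"] by blast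
    show "connected_component (- (?B \<union> ?C)) x y"
      unfolding connected_component_def using xo(2) yo(3) BC(4) outside_no_overlap[of "?B \<union> ?C"] by blast
  qed
  then have "connected_component (- (?A \<union> ?B)) x y"
    by (rule connected_component_of_subset) blast
  then have "y \<in> inside (?A \<union> ?B)"
    using inside_same_component[OF _ x] by blast
  then show False using yo(1) inside_Int_outside[of "?A \<union> ?B"] by blast
qed

section \<open>Outerplanar graphs have no theta subgraph\<close>

text \<open>The lists hold inner vertices only. That they are nonempty provides, on each drawn arc,
  a vertex off the ends that has to lie on the outer face.\<close>

definition theta_subgraph :: "('a \<Rightarrow> 'a \<Rightarrow> bool) \<Rightarrow> bool" where
  "theta_subgraph E \<longleftrightarrow> (\<exists>a b P Q R. P \<noteq> [] \<and> Q \<noteq> [] \<and> R \<noteq> [] \<and> distinct (a # b # P @ Q @ R) \<and>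
     successively E (a # P @ [b]) \<and> successively E (a # Q @ [b]) \<and> successively E (a # R @ [b]))"

section \<open>Paths of the graph as arcs in the plane\<close>

fun path_edges :: "'a list \<Rightarrow> 'a set set" where
  "path_edges (x # y # L) = insert {x, y} (path_edges (y # L))"
| "path_edges L = {}"

lemma path_edges_subset: "e \<in> path_edges L \<Longrightarrow> e \<subseteq> set L"
  by (induction L rule: path_edges.induct) auto

text \<open>Serves to tell the edges of two internally disjoint paths apart: a common edge would
  carry an inner vertex of the first path into the second.\<close>

lemma path_edges_meet_inner:
  "distinct (a # P @ [b]) \<Longrightarrow> P \<noteq> [] \<Longrightarrow> e \<in> path_edges (a # P @ [b]) \<Longrightarrow> e \<inter> set P \<noteq> {}"
proof (induction P arbitrary: a)
  case (Cons p P)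
  then show ?case by (cases P) auto
qed simp

lemma in_path_edge:
  "v \<in> set L \<Longrightarrow> 2 \<le> length L \<Longrightarrow> \<exists>e \<in> path_edges L. v \<in> e"
proof (induction L rule: path_edges.induct)
  case (1 x y L)
  then show ?case by (cases L) auto
qed auto

lemma path_edges_edges_of:
  "successively (\<lambda>u v. (u, v) \<in> parcs G) L \<Longrightarrow> path_edges L \<subseteq> edges_of G"
  by (induction L rule: path_edges.induct) (auto simp: edges_of_def)

lemma planar_drawing_edges_meet:
  assumes "planar_drawing G pt curve" "e \<in> edges_of G" "f \<in> edges_of G" "e \<noteq> f"
  shows "path_image (curve e) \<inter> path_image (curve f) = pt ` (e \<inter> f)"
  using assms by (simp add: planar_drawing_def)

lemma planar_drawing_ends:
  assumes "planar_drawing G pt curve" "e \<in> edges_of G"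
  shows "pt ` e \<subseteq> path_image (curve e)"
  using assms unfolding planar_drawing_def by (metis Int_lower1)

text \<open>A drawing does not fix at which end the curve of an edge starts; reversing the curve
  gives the desired direction.\<close>

lemma planar_drawing_edge_arc:
  assumes "planar_drawing G pt curve" "{x, y} \<in> edges_of G"
  obtains c where "arc c" "pathstart c = pt x" "pathfinish c = pt y"
    "path_image c = path_image (curve {x, y})"
proof -
  have c: "arc (curve {x, y})" "{pathstart (curve {x, y}), pathfinish (curve {x, y})} = {pt x, pt y}"
    using assms by (auto simp: planar_drawing_def)
  then consider "pathstart (curve {x, y}) = pt x" "pathfinish (curve {x, y}) = pt y"
    | "pathstart (curve {x, y}) = pt y" "pathfinish (curve {x, y}) = pt x"
    by (auto simp: doubleton_eq_iff)
  then show ?thesis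
  proof cases
    case 1
    then show ?thesis using c that by blast
  next
    case 2
    then show ?thesis using c that[of "reversepath (curve {x, y})"] by (simp add: arc_reversepath)
  qed
qed

text \<open>The arc of the tail is prolonged by the curve of \<open>{x, y}\<close>. As
  \<open>x\<close> occurs in no later edge, the two pieces meet in the drawn point of
  \<open>y\<close> only.\<close>

lemma planar_drawing_path_arc:
  assumes pd: "planar_drawing G pt curve"
  shows "successively (\<lambda>u v. (u, v) \<in> parcs G) L \<Longrightarrow> distinct L \<Longrightarrow> 2 \<le> length L \<Longrightarrow>
    \<exists>g. arc g \<and> pathstart g = pt (hd L) \<and> pathfinish g = pt (last L) \<and>
      path_image g = (\<Union>e \<in> path_edges L. path_image (curve e))"
proof (induction L rule: path_edges.induct)
  case (1 x y L)
  have edges: "path_edges (x # y # L) \<subseteq> edges_of G"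
    using path_edges_edges_of[OF "1.prems"(1)] .
  then have "{x, y} \<in> edges_of G" by simp
  then obtain c where c: "arc c" "pathstart c = pt x" "pathfinish c = pt y"
    "path_image c = path_image (curve {x, y})"
    by (rule planar_drawing_edge_arc[OF pd])
  show ?case
  proof (cases "L = []")
    case True
    then show ?thesis using c by auto
  next
    case False
    then obtain g where g: "arc g" "pathstart g = pt y" "pathfinish g = pt (last (y # L))"
      "path_image g = (\<Union>e \<in> path_edges (y # L). path_image (curve e))"
      using 1 by (auto simp: Suc_le_eq)
    have "path_image (curve {x, y}) \<inter> path_image (curve e) \<subseteq> {pt y}"
      if e: "e \<in> path_edges (y # L)" for e
    proof -
      have "x \<notin> e" using path_edges_subset[OF e] "1.prems"(2) by auto
      moreover have "path_image (curve {x, y}) \<inter> path_image (curve e) = pt ` ({x, y} \<inter> e)"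
      proof -
        have "{x, y} \<noteq> e" "e \<in> edges_of G" using \<open>x \<notin> e\<close> e edges by auto
        then show ?thesis using planar_drawing_edges_meet[OF pd \<open>{x, y} \<in> edges_of G\<close>] by blast
      qed
      ultimately show ?thesis by auto
    qed
    then have "path_image c \<inter> path_image g \<subseteq> {pathstart g}"
      unfolding c(4) g(2,4) by blast
    then have "arc (c +++ g)" using c g by (intro arc_join) auto
    then show ?thesis
      using c g False by (intro exI[of _ "c +++ g"]) (simp add: path_image_join)
  qed
qed auto

theorem outerplanar_no_theta_subgraph:
  assumes "outerplanar G" and verts: "\<And>u v. (u, v) \<in> parcs G \<Longrightarrow> u \<in> pverts G \<and> v \<in> pverts G"
  shows "\<not> theta_subgraph (\<lambda>u v. (u, v) \<in> parcs G)"
proof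
  assume "theta_subgraph (\<lambda>u v. (u, v) \<in> parcs G)"
  then obtain a b P Q R where ne: "P \<noteq> []" "Q \<noteq> []" "R \<noteq> []"
    and dist: "distinct (a # b # P @ Q @ R)"
    and walks: "successively (\<lambda>u v. (u, v) \<in> parcs G) (a # P @ [b])"
      "successively (\<lambda>u v. (u, v) \<in> parcs G) (a # Q @ [b])"
      "successively (\<lambda>u v. (u, v) \<in> parcs G) (a # R @ [b])"
    unfolding theta_subgraph_def by blast
  from assms(1) obtain pt curve where pd: "planar_drawing G pt curve"
    and outer: "pt ` pverts G \<subseteq> frontier (outside (drawing_points G pt curve))"
    unfolding outerplanar_def by blast
  let ?img = "\<lambda>L. \<Union>e \<in> path_edges (a # L @ [b]). path_image (curve e)"
  have inj: "inj_on pt (pverts G)" using pd by (simp add: planar_drawing_def)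
  have in_verts: "v \<in> pverts G" if "successively (\<lambda>u v. (u, v) \<in> parcs G) (a # L @ [b])"
    "v \<in> {a, b} \<union> set L" for v L
  proof -
    have "v \<in> set (a # L @ [b])" using that by auto
    then obtain e where "e \<in> path_edges (a # L @ [b])" "v \<in> e"
      using in_path_edge[of v "a # L @ [b]"] by auto
    then show ?thesis using path_edges_edges_of[OF that(1)] verts by (auto simp: edges_of_def)
  qed
  have path: "\<exists>g. arc g \<and> pathstart g = pt a \<and> pathfinish g = pt b \<and> path_image g = ?img L"
    if "successively (\<lambda>u v. (u, v) \<in> parcs G) (a # L @ [b])" "distinct (a # b # L)" for L
    using planar_drawing_path_arc[OF pd that(1)] that(2) by auto
  have sub: "?img L \<subseteq> drawing_points G pt curve"
    if "successively (\<lambda>u v. (u, v) \<in> parcs G) (a # L @ [b])" for L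
    using path_edges_edges_of[OF that] by (auto simp: drawing_points_def)
  have vertex: "pt v \<in> ?img L"
    if walk: "successively (\<lambda>u v. (u, v) \<in> parcs G) (a # L @ [b])" and v: "v \<in> {a, b} \<union> set L" for v L
  proof -
    have "v \<in> set (a # L @ [b])" using v by auto
    then obtain e where e: "e \<in> path_edges (a # L @ [b])" "v \<in> e"
      using in_path_edge[of v "a # L @ [b]"] by auto
    then have "e \<in> edges_of G" using path_edges_edges_of[OF walk] by auto
    then have "pt ` e \<subseteq> path_image (curve e)" by (rule planar_drawing_ends[OF pd])
    then show ?thesis using e by blast
  qed
  have disj: "?img L \<inter> ?img M = {pt a, pt b}"
    if walk: "successively (\<lambda>u v. (u, v) \<in> parcs G) (a # L @ [b])"
        "successively (\<lambda>u v. (u, v) \<in> parcs G) (a # M @ [b])"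
      and d: "distinct (a # b # L @ M)" and ne: "L \<noteq> []" for L M
  proof
    show "{pt a, pt b} \<subseteq> ?img L \<inter> ?img M" using vertex walk by blast
    show "?img L \<inter> ?img M \<subseteq> {pt a, pt b}"
    proof
      fix z
      assume "z \<in> ?img L \<inter> ?img M"
      then obtain e f where e: "e \<in> path_edges (a # L @ [b])" and f: "f \<in> path_edges (a # M @ [b])"
        and z: "z \<in> path_image (curve e)" "z \<in> path_image (curve f)"
        by blast
      have "e \<inter> set L \<noteq> {}" using path_edges_meet_inner[OF _ ne e] d by auto
      moreover have ef: "e \<subseteq> {a, b} \<union> set L" "f \<subseteq> {a, b} \<union> set M"
        using path_edges_subset[OF e] path_edges_subset[OF f] by auto
      ultimately have "e \<noteq> f" using d by auto
      moreover have "e \<in> edges_of G" "f \<in> edges_of G"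
        using e f path_edges_edges_of walk by blast+
      ultimately have "z \<in> pt ` (e \<inter> f)" using planar_drawing_edges_meet[OF pd] z by blast
      moreover have "e \<inter> f \<subseteq> {a, b}" using ef d by auto
      ultimately show "z \<in> {pt a, pt b}" by blast
    qed
  qed
  have q: "pt (hd L) \<in> ?img L - {pt a, pt b}" "pt (hd L) \<in> frontier (outside (drawing_points G pt curve))"
    if walk: "successively (\<lambda>u v. (u, v) \<in> parcs G) (a # L @ [b])"
      and d: "distinct (a # b # L)" and ne: "L \<noteq> []" for L
  proof -
    have "hd L \<in> set L" using ne by simp
    moreover from this have "hd L \<noteq> a" "hd L \<noteq> b" using d by auto
    moreover have "hd L \<in> pverts G" "a \<in> pverts G" "b \<in> pverts G"
      using in_verts[OF walk] \<open>hd L \<in> set L\<close> by auto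
    ultimately show "pt (hd L) \<in> ?img L - {pt a, pt b}"
      "pt (hd L) \<in> frontier (outside (drawing_points G pt curve))"
      using vertex[OF walk, of "hd L"] inj outer by (auto dest: inj_onD)
  qed
  have ds: "distinct (a # b # P)" "distinct (a # b # Q)" "distinct (a # b # R)"
    "distinct (a # b # P @ Q)" "distinct (a # b # P @ R)" "distinct (a # b # Q @ R)"
    using dist by auto
  obtain g h k where g: "arc g" "pathstart g = pt a" "pathfinish g = pt b" "path_image g = ?img P"
    and h: "arc h" "pathstart h = pt a" "pathfinish h = pt b" "path_image h = ?img Q"
    and k: "arc k" "pathstart k = pt a" "pathfinish k = pt b" "path_image k = ?img R"
    using path walks ds by meson
  show False
    by (rule no_theta_curve_on_outer_face[OF g(1) h(1) k(1) g(2) h(2) k(2) g(3) h(3) k(3),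
          unfolded g(4) h(4) k(4), OF disj[OF walks(1,2) ds(4) ne(1)] disj[OF walks(1,3) ds(5) ne(1)]
          disj[OF walks(2,3) ds(6) ne(2)] sub[OF walks(1)] sub[OF walks(2)] sub[OF walks(3)]
          q[OF walks(1) ds(1) ne(1)] q[OF walks(2) ds(2) ne(2)] q[OF walks(3) ds(3) ne(3)]])
qed

section \<open>Colours along a path\<close>

text \<open>Only the three packing colours are symmetric, so a renaming of colours has to fix
  \<open>0\<close>; a permutation of \<open>{1, 2, 3}\<close> does, being the identity
  elsewhere.\<close>

lemma permutes_123:
  fixes \<pi> :: "nat \<Rightarrow> nat"
  assumes "\<pi> permutes {1, 2, 3}"
  shows "\<pi> x = 0 \<longleftrightarrow> x = 0" "x < 4 \<Longrightarrow> \<pi> x < 4"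
proof -
  have "\<pi> 0 = 0" using permutes_not_in[OF assms, of 0] by simp
  then show "\<pi> x = 0 \<longleftrightarrow> x = 0" using permutes_inj[OF assms] by (metis injD)
  assume "x < 4"
  then consider "x = 0" | "x \<in> {1, 2, 3}" by force
  then show "\<pi> x < 4"
  proof cases
    case 2
    then have "\<pi> x \<in> {1, 2, 3}" using permutes_in_image[OF assms] by blast
    then show ?thesis by auto
  qed (use \<open>\<pi> 0 = 0\<close> in simp)
qed

lemma transpose_permutes_123:
  fixes x y :: nat
  shows "x \<in> {1, 2, 3} \<Longrightarrow> y \<in> {1, 2, 3} \<Longrightarrow> Transposition.transpose x y permutes {1, 2, 3}"
  by (rule permutes_swap_id)

lemma fresh_colour:
  fixes a b :: nat
  obtains t where "t \<in> {1, 2, 3}" "t \<noteq> a" "t \<noteq> b"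
proof -
  consider "1 \<noteq> a" "1 \<noteq> b" | "2 \<noteq> a" "2 \<noteq> b" | "3 \<noteq> a" "3 \<noteq> b" by linarith
  then show ?thesis by cases (use that[of 1] that[of 2] that[of 3] in simp_all)
qed

text \<open>In use, \<open>x\<close> and \<open>y\<close> are the colours of the ends of a cut edge,
  and \<open>x'\<close> and \<open>y'\<close> the only packing colours next to them. Moving
  \<open>y\<close> to the colour outside \<open>{x, x'}\<close> gives the first two inequalities; if
  \<open>y'\<close> lands on \<open>x\<close>, exchanging \<open>x\<close> and \<open>x'\<close>
  afterwards repairs this and keeps that third colour fixed.\<close>

lemma separating_permutation:
  fixes x x' y y' :: nat
  assumes "x \<in> {1, 2, 3}" "x' \<in> {1, 2, 3}" "y \<in> {1, 2, 3}" "y' \<in> {1, 2, 3}" "x \<noteq> x'" "y \<noteq> y'"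
  obtains \<pi> where "\<pi> permutes {1, 2, 3}" "\<pi> y \<noteq> x" "\<pi> y \<noteq> x'" "\<pi> y' \<noteq> x"
proof -
  obtain t :: nat where t: "t \<in> {1, 2, 3}" "t \<noteq> x" "t \<noteq> x'"
    by (rule fresh_colour)
  let ?\<sigma> = "Transposition.transpose y t"
  have \<sigma>: "?\<sigma> permutes {1, 2, 3}" by (rule transpose_permutes_123[OF assms(3) t(1)])
  have "?\<sigma> y' \<noteq> t" using assms(6) by (metis transpose_apply_first transpose_involutory)
  show ?thesis
  proof (cases "?\<sigma> y' = x")
    case True
    have "Transposition.transpose x x' \<circ> ?\<sigma> permutes {1, 2, 3}"
      by (rule permutes_compose[OF \<sigma> transpose_permutes_123[OF assms(1,2)]])
    moreover have "Transposition.transpose x x' t = t" using t by (simp add: transpose_apply_other)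
    ultimately show ?thesis using that[of "Transposition.transpose x x' \<circ> ?\<sigma>"] t True assms(5) by simp
  next
    case False
    then show ?thesis using that[OF \<sigma>] t by simp
  qed
qed

lemma card_le_2E:
  assumes "finite S" "card S \<le> 2"
  obtains a b where "S \<subseteq> {a, b}"
proof -
  consider "card S = 0" | "card S = 1" | "card S = 2" using assms(2) by linarith
  then show ?thesis
  proof cases
    case 1
    then show ?thesis using assms that by auto
  next
    case 2
    then show ?thesis using that by (metis card_1_singletonE insertI1 singletonD subsetI insertCI)
  next
    case 3
    then show ?thesis using that by (metis card_2_iff order_refl)
  qed
qed

text \<open>The demands of \<open>good\<close> along a path at positions \<open>m\<close> to
  \<open>n\<close>, both included: \<open>i\<close> is always the first of the two positions
  compared.\<close>

definition proper_upto :: "nat \<Rightarrow> nat \<Rightarrow> (nat \<Rightarrow> nat) \<Rightarrow> bool" where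
  "proper_upto m n s \<longleftrightarrow> (\<forall>i. m \<le> i \<longrightarrow> i < n \<longrightarrow> s i \<noteq> s (Suc i)) \<and>
     (\<forall>i. m \<le> i \<longrightarrow> Suc i < n \<longrightarrow> s i \<noteq> s (Suc (Suc i)) \<or> s i = 0)"

text \<open>The pattern is \<open>z 0 t 0 z 0 t 0 ...\<close>; for odd \<open>k\<close> its last
  block is \<open>z t 0\<close> or \<open>t z 0\<close>. Equal nonzero colours are at least three
  apart.\<close>

lemma two_colour_path:
  assumes "2 \<le> k" "z \<noteq> t" "z \<noteq> 0" "t \<noteq> 0"
  shows "\<exists>s. s 1 = z \<and> s k = 0 \<and> (\<forall>i. s i \<in> {0, z, t}) \<and> proper_upto 1 k s"
  using assms
proof (induction k arbitrary: z t rule: less_induct)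
  case (less k)
  consider "k = 2" | "k = 3" | "4 \<le> k" using less.prems(1) by linarith
  then show ?case
  proof cases
    case 1
    then show ?thesis using less.prems
      by (intro exI[of _ "\<lambda>i. if i = 1 then z else 0"]) (auto simp: proper_upto_def)
  next
    case 2
    then show ?thesis using less.prems
      by (intro exI[of _ "\<lambda>i. if i = 1 then z else if i = 2 then t else 0"])
        (auto simp: proper_upto_def less_Suc_eq numeral_3_eq_3 numeral_2_eq_2)
  next
    case 3
    then have kk: "k - 2 < k" "2 \<le> k - 2" "t \<noteq> z" using less.prems by auto
    \<comment> \<open>\<open>z\<close> and \<open>t\<close> change roles, so that positions
      \<open>1\<close> and \<open>3\<close> differ.\<close>
    then obtain s where s: "s 1 = t" "s (k - 2) = 0" "\<forall>i. s i \<in> {0, t, z}" "proper_upto 1 (k - 2) s"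
      using less.IH[of "k - 2" t z] less.prems kk by blast
    let ?s = "\<lambda>i. if i = 1 then z else if i = 2 then 0 else s (i - 2)"
    have "?s i \<noteq> ?s (Suc i)" if i: "1 \<le> i" "i < k" for i
    proof -
      consider "i = 1" | "i = 2" | j where "i = Suc (Suc j)" "1 \<le> j"
        using i by (metis One_nat_def Suc_1 Suc_le_D Suc_le_mono le_zero_eq not_less_eq_eq not0_implies_Suc)
      then show ?thesis
        by cases (use i s less.prems in \<open>auto simp: proper_upto_def\<close>)
    qed
    moreover have "?s i \<noteq> ?s (Suc (Suc i)) \<or> ?s i = 0" if i: "1 \<le> i" "Suc i < k" for i
    proof -
      consider "i = 1" | "i = 2" | j where "i = Suc (Suc j)" "1 \<le> j"
        using i by (metis One_nat_def Suc_1 Suc_le_D Suc_le_mono le_zero_eq not_less_eq_eq not0_implies_Suc)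
      then show ?thesis
        by cases (use i s less.prems in \<open>auto simp: proper_upto_def\<close>)
    qed
    ultimately have "proper_upto 1 k ?s" by (auto simp: proper_upto_def)
    moreover have "?s k = 0" using 3 s by auto
    moreover have "?s i \<in> {0, z, t}" for i using s(3)[rule_format, of "i - 2"] by auto
    ultimately show ?thesis by (intro exI[of _ ?s] conjI allI) simp_all
  qed
qed

text \<open>For an end coloured \<open>0\<close>. The \<open>0\<close> before \<open>x\<close> is
  exempt from the distance-2 condition and \<open>x\<close> is not among \<open>0\<close>,
  \<open>z\<close>, \<open>t\<close>, so outside the path only the colour \<open>z\<close> next to
  the first end is felt.\<close>

lemma colour_path_from_0:
  assumes "2 \<le> k" "z \<noteq> t" "z \<noteq> 0" "t \<noteq> 0" "x \<noteq> 0" "x \<noteq> z" "x \<noteq> t"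
  shows "\<exists>s. s 0 = 0 \<and> s 1 = z \<and> s k = 0 \<and> s (Suc k) = x \<and> (\<forall>i. s i \<in> {0, x, z, t}) \<and>
    proper_upto 0 (Suc k) s"
proof -
  obtain s where s: "s 1 = z" "s k = 0" "\<forall>i. s i \<in> {0, z, t}" "proper_upto 1 k s"
    using two_colour_path[OF assms(1-4)] by blast
  let ?s = "\<lambda>i. if i = 0 then 0 else if i = Suc k then x else s i"
  have "s i \<noteq> x" for i using s(3)[rule_format, of i] assms by auto
  then have "proper_upto 0 (Suc k) ?s"
    using s(1,2,4) assms(1,3,5) unfolding proper_upto_def by (auto simp: less_Suc_eq)
  moreover have "?s i \<in> {0, x, z, t}" for i using s(3)[rule_format, of i] by auto
  ultimately show ?thesis using s(1,2) assms(1) by (intro exI[of _ ?s] conjI allI) simp_all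
qed

text \<open>For two ends with packing colours. The pattern is \<open>x 0 z y\<close> for
  \<open>k = 2\<close>; otherwise \<open>x 0\<close> is followed by a pattern of
  \<open>two_colour_path\<close> that ends in \<open>0\<close>, and then by \<open>y\<close>.
  Outside the path, at most a colour \<open>z\<close> before \<open>y\<close> is felt.\<close>

lemma colour_path_nonzero:
  assumes "2 \<le> k" "x \<noteq> y" "x \<noteq> z" "y \<noteq> z" "x \<noteq> 0" "y \<noteq> 0" "z \<noteq> 0"
  shows "\<exists>s. s 0 = x \<and> s 1 = 0 \<and> s k \<in> {0, z} \<and> s (Suc k) = y \<and> (\<forall>i. s i \<in> {0, x, y, z}) \<and>
    proper_upto 0 (Suc k) s"
proof (cases "k = 2")
  case True
  let ?s = "\<lambda>i :: nat. if i = 0 then x else if i = 1 then 0 else if i = 2 then z else y"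
  have "proper_upto 0 (Suc k) ?s"
    using True assms unfolding proper_upto_def by (auto simp: less_Suc_eq numeral_2_eq_2)
  then show ?thesis using True by (intro exI[of _ ?s]) auto
next
  case False
  then have kk: "2 \<le> k - 1" using assms(1) by linarith
  \<comment> \<open>The colour \<open>x\<close> can be reused: position \<open>2\<close> has colour
    \<open>z\<close>, so \<open>x\<close> recurs at position \<open>3\<close> at the
    earliest.\<close>
  then obtain s where s: "s 1 = z" "s (k - 1) = 0" "\<forall>i. s i \<in> {0, z, x}" "proper_upto 1 (k - 1) s"
    using two_colour_path[of "k - 1" z x] assms by metis
  let ?s = "\<lambda>i. if i = 0 then x else if i = 1 then 0 else if i = Suc k then y else s (i - 1)"
  have sy: "s i \<noteq> y" for i using s(3)[rule_format, of i] assms by auto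
  have "?s i \<noteq> ?s (Suc i)" if i: "i < Suc k" for i
  proof -
    consider "i = 0" | "i = 1" | "i = k" | j where "i = Suc j" "1 \<le> j" "j < k - 1"
      using i by (cases i) force+
    then show ?thesis
      by cases (use s assms sy False in \<open>auto simp: proper_upto_def\<close>)
  qed
  moreover have "?s i \<noteq> ?s (Suc (Suc i)) \<or> ?s i = 0" if i: "Suc i < Suc k" for i
  proof -
    consider "i = 0" | "i = 1" | "Suc i = k" "1 < i" | j where "i = Suc j" "1 \<le> j" "Suc j < k - 1"
      using i by (cases i) force+
    then show ?thesis
      by cases (use s assms sy False in \<open>auto simp: proper_upto_def\<close>)
  qed
  ultimately have "proper_upto 0 (Suc k) ?s" by (auto simp: proper_upto_def)
  moreover have "?s i \<in> {0, x, y, z}" for i using s(3)[rule_format, of "i - 1"] by auto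
  ultimately show ?thesis using s(2) assms(1) False by (intro exI[of _ ?s] conjI allI) simp_all
qed

section \<open>Combining colourings across a cut\<close>

text \<open>Induced subgraphs are represented by vertex sets \<open>U\<close> below, so these facts
  about the whole graph serve at every stage of the induction.\<close>

locale cubic_no_theta =
  fixes E :: "'a \<Rightarrow> 'a \<Rightarrow> bool"
  assumes sym: "E u v \<Longrightarrow> E v u"
    and irrefl: "\<not> E u u"
    and finite_nbrs: "finite {v. E u v}"
    and degree: "card {v. E u v} \<le> 3"
    and no_triangle: "E u v \<Longrightarrow> E v w \<Longrightarrow> \<not> E w u"
    and no_theta: "\<not> theta_subgraph E"
begin

text \<open>Colour \<open>0\<close> is the independent class, the colours \<open>1, 2, 3\<close> are the \<open>2\<close>-packings.\<close>

definition good :: "'a set \<Rightarrow> ('a \<Rightarrow> nat) \<Rightarrow> bool" where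
  "good U c \<longleftrightarrow> (\<forall>v\<in>U. c v < 4) \<and> (\<forall>u\<in>U. \<forall>v\<in>U. E u v \<longrightarrow> c u \<noteq> c v) \<and>
     (\<forall>u\<in>U. \<forall>v\<in>U. \<forall>w\<in>U. E u v \<longrightarrow> E v w \<longrightarrow> u \<noteq> w \<longrightarrow> c u \<noteq> c w \<or> c u = 0)"

text \<open>Degree at most \<open>2\<close> in the subgraph induced by \<open>U\<close>. The
  vertices \<open>a\<close> and \<open>b\<close> may coincide or lie outside \<open>U\<close>;
  naming them lets a colour be chosen that differs from both of theirs.\<close>

definition low :: "'a set \<Rightarrow> 'a \<Rightarrow> bool" where
  "low U u \<longleftrightarrow> (\<exists>a b. \<forall>w\<in>U. E u w \<longrightarrow> w \<in> {a, b})"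

text \<open>Of at most three neighbours, \<open>p\<close> does not count in \<open>U\<close>. This
  applies to both ends of a cut edge and to both ends of an ear.\<close>

lemma low_if_outer_nbr:
  assumes "E u p" "p \<notin> U"
  shows "low U u"
proof -
  have "{v \<in> U. E u v} \<subseteq> {v. E u v} - {p}" using assms by auto
  then have "card {v \<in> U. E u v} \<le> card ({v. E u v} - {p})"
    by (intro card_mono) (auto intro: finite_nbrs)
  also have "\<dots> \<le> 2" using assms degree[of u] by (simp add: finite_nbrs)
  finally have card: "card {v \<in> U. E u v} \<le> 2" .
  have "finite {v \<in> U. E u v}" by (rule finite_subset[OF _ finite_nbrs[of u]]) auto
  then obtain a b where "{v \<in> U. E u v} \<subseteq> {a, b}" using card by (rule card_le_2E)
  then show ?thesis unfolding low_def by blast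
qed

lemma no_four_nbrs:
  assumes "E u a" "E u b" "E u c" "E u d" "distinct [a, b, c, d]"
  shows False
proof -
  have "card {a, b, c, d} \<le> card {v. E u v}"
    using assms by (intro card_mono finite_nbrs) auto
  then show False using assms(5) degree[of u] by simp
qed

lemma not_low:
  assumes "low U u" "E u a" "E u b" "E u c" "a \<in> U" "b \<in> U" "c \<in> U" "a \<noteq> b" "b \<noteq> c" "a \<noteq> c"
  shows False
  using assms unfolding low_def by blast

lemma low_mono: "low U u \<Longrightarrow> V \<subseteq> U \<Longrightarrow> low V u"
  unfolding low_def by blast

lemma good_lt_4: "good U c \<Longrightarrow> v \<in> U \<Longrightarrow> c v < 4"
  by (simp add: good_def)

lemma good_adj: "good U c \<Longrightarrow> u \<in> U \<Longrightarrow> v \<in> U \<Longrightarrow> E u v \<Longrightarrow> c u \<noteq> c v"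
  by (simp add: good_def)

lemma good_dist2:
  "good U c \<Longrightarrow> u \<in> U \<Longrightarrow> v \<in> U \<Longrightarrow> w \<in> U \<Longrightarrow> E u v \<Longrightarrow> E v w \<Longrightarrow> u \<noteq> w \<Longrightarrow> c u \<noteq> c w \<or> c u = 0"
  by (simp add: good_def)

lemma good_123: "good U c \<Longrightarrow> v \<in> U \<Longrightarrow> c v \<noteq> 0 \<Longrightarrow> c v \<in> {1, 2, 3}"
  using good_lt_4[of U c v] by auto

lemma goodI:
  assumes "\<And>v. v \<in> U \<Longrightarrow> c v < 4"
    and "\<And>u v. u \<in> U \<Longrightarrow> v \<in> U \<Longrightarrow> E u v \<Longrightarrow> c u \<noteq> c v"
    and "\<And>u v w. u \<in> U \<Longrightarrow> v \<in> U \<Longrightarrow> w \<in> U \<Longrightarrow> E u v \<Longrightarrow> E v w \<Longrightarrow> u \<noteq> w \<Longrightarrow> c u \<noteq> c w \<or> c u = 0"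
  shows "good U c"
  unfolding good_def by (intro conjI ballI impI; rule assms; assumption)

text \<open>Colour \<open>0\<close> is exempt from the distance-2 condition, so only adjacency could
  fail.\<close>

lemma good_recolour_0:
  assumes c: "good U c" and u: "\<And>w. w \<in> U \<Longrightarrow> E u w \<Longrightarrow> c w \<noteq> 0"
  shows "good U (c(u := 0))"
proof (rule goodI)
  fix x y assume xy: "x \<in> U" "y \<in> U" "E x y"
  then have "x \<noteq> y" using irrefl by auto
  then show "(c(u := 0)) x \<noteq> (c(u := 0)) y"
    using good_adj[OF c xy] u[of x] u[of y] sym[of x y] xy by auto
next
  fix x y w assume "x \<in> U" "y \<in> U" "w \<in> U" "E x y" "E y w" "x \<noteq> w"
  then show "(c(u := 0)) x \<noteq> (c(u := 0)) w \<or> (c(u := 0)) x = 0"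
    using good_dist2[OF c, of x y w] by auto
qed (use good_lt_4[OF c] in simp)

lemma good_permute:
  assumes c: "good U c" and \<pi>: "\<pi> permutes {1, 2, 3}"
  shows "good U (\<lambda>x. \<pi> (c x))"
proof -
  have "\<pi> (c x) = \<pi> (c y) \<longleftrightarrow> c x = c y" for x y
    using permutes_inj[OF \<pi>] by (simp add: inj_eq)
  then show ?thesis
    using c permutes_123[OF \<pi>] unfolding good_def by simp
qed

text \<open>By \<open>unique\<close> at most one edge crosses, so no path of length two between
  distinct vertices leaves a side and returns to it. Any other mixed path of length two uses the
  crossing edge and is handled by \<open>cross\<close>.\<close>

lemma good_union:
  assumes c: "good A c" and d: "good B d" and disj: "A \<inter> B = {}"
    and unique: "\<And>x y x' y'. x \<in> A \<Longrightarrow> y \<in> B \<Longrightarrow> E x y \<Longrightarrow> x' \<in> A \<Longrightarrow> y' \<in> B \<Longrightarrow> E x' y' \<Longrightarrow> x = x' \<and> y = y'"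
    and cross: "\<And>x y. x \<in> A \<Longrightarrow> y \<in> B \<Longrightarrow> E x y \<Longrightarrow> c x \<noteq> d y \<and>
      (\<forall>w\<in>A. E x w \<longrightarrow> c w \<noteq> d y \<or> d y = 0) \<and> (\<forall>w\<in>B. E y w \<longrightarrow> d w \<noteq> c x \<or> c x = 0)"
  shows "good (A \<union> B) (\<lambda>x. if x \<in> A then c x else d x)" (is "good _ ?e")
proof (rule goodI)
  fix x y assume xy: "x \<in> A \<union> B" "y \<in> A \<union> B" "E x y"
  then have "E y x" by (blast intro: sym)
  have notA: "v \<notin> A" if "v \<in> B" for v using disj that by blast
  consider "x \<in> A" "y \<in> A" | "x \<in> B" "y \<in> B" | "x \<in> A" "y \<in> B" | "x \<in> B" "y \<in> A" using xy(1,2) by blast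
  then show "?e x \<noteq> ?e y"
    by cases (use xy notA good_adj[OF c] good_adj[OF d] cross[of x y] cross[of y x] \<open>E y x\<close> in auto)
next
  fix x y z assume xyz: "x \<in> A \<union> B" "y \<in> A \<union> B" "z \<in> A \<union> B" "E x y" "E y z" "x \<noteq> z"
  then have E: "E y x" "E z y" by (blast intro: sym)+
  have notA: "v \<notin> A" if "v \<in> B" for v using disj that by blast
  consider "x \<in> A" "y \<in> A" "z \<in> A" | "x \<in> B" "y \<in> B" "z \<in> B"
    | "x \<in> A" "y \<in> A" "z \<in> B" | "x \<in> B" "y \<in> A" "z \<in> A"
    | "x \<in> A" "y \<in> B" "z \<in> B" | "x \<in> B" "y \<in> B" "z \<in> A"
    | "x \<in> A" "y \<in> B" "z \<in> A" | "x \<in> B" "y \<in> A" "z \<in> B"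
    using xyz(1-3) by blast
  then show "?e x \<noteq> ?e z \<or> ?e x = 0"
  proof cases
    case 1
    then show ?thesis using good_dist2[OF c _ _ _ xyz(4-6)] by simp
  next
    case 2
    then show ?thesis using good_dist2[OF d _ _ _ xyz(4-6)] notA by simp
  next
    case 3
    then have "c x \<noteq> d z \<or> d z = 0" using cross[OF 3(2,3) xyz(5)] 3(1) E(1) by simp
    then show ?thesis using 3 notA by auto
  next
    case 4
    then have "c z \<noteq> d x \<or> d x = 0" using cross[OF 4(2,1) E(1)] 4(3) xyz(5) by simp
    then show ?thesis using 4 notA by auto
  next
    case 5
    then have "d z \<noteq> c x \<or> c x = 0" using cross[OF 5(1,2) xyz(4)] 5(3) xyz(5) by simp
    then show ?thesis using 5 notA by auto
  next
    case 6
    then have "d x \<noteq> c z \<or> c z = 0" using cross[OF 6(3,2) E(2)] 6(1) E(1) by simp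
    then show ?thesis using 6 notA by auto
  next
    case 7
    then show ?thesis using unique[of x y z y] xyz E by blast
  next
    case 8
    then show ?thesis using unique[of y x y z] xyz E by blast
  qed
next
  fix v assume "v \<in> A \<union> B"
  then show "?e v < 4" using good_lt_4[OF c] good_lt_4[OF d] by auto
qed

lemma colour_avoiding_nbrs:
  assumes "low U u"
  obtains t where "t \<in> {1, 2, 3 :: nat}" "\<And>w. w \<in> U \<Longrightarrow> E u w \<Longrightarrow> c w \<noteq> t"
proof -
  obtain a b where ab: "\<forall>w\<in>U. E u w \<longrightarrow> w \<in> {a, b}" using assms unfolding low_def by blast
  obtain t :: nat where t: "t \<in> {1, 2, 3}" "t \<noteq> c a" "t \<noteq> c b" by (rule fresh_colour)
  show ?thesis
  proof (rule that[OF t(1)])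
    fix w assume "w \<in> U" "E u w"
    then have "w = a \<or> w = b" using ab by blast
    then show "c w \<noteq> t" using t by auto
  qed
qed

text \<open>Two neighbours with packing colours are all the neighbours of a low vertex, so nothing
  prevents colour \<open>0\<close>. Otherwise at most one neighbour has a packing colour, and a
  third one remains free.\<close>

lemma saturated_or_one_colour:
  assumes c: "good U c" and u: "u \<in> U" "low U u" "c u \<noteq> 0"
  obtains (saturated) "good U (c(u := 0))"
      "\<exists>w1\<in>U. \<exists>w2\<in>U. E u w1 \<and> E u w2 \<and> w1 \<noteq> w2"
  | (one_colour) x where "x \<in> {1, 2, 3}" "x \<noteq> c u" "\<And>w. w \<in> U \<Longrightarrow> E u w \<Longrightarrow> c w = 0 \<or> c w = x"
proof (cases "\<exists>w1\<in>U. \<exists>w2\<in>U. E u w1 \<and> E u w2 \<and> w1 \<noteq> w2 \<and> c w1 \<noteq> 0 \<and> c w2 \<noteq> 0")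
  case True
  then obtain w1 w2 where w: "w1 \<in> U" "w2 \<in> U" "E u w1" "E u w2" "w1 \<noteq> w2" "c w1 \<noteq> 0" "c w2 \<noteq> 0"
    by blast
  have "c w \<noteq> 0" if "w \<in> U" "E u w" for w
    using not_low[OF u(2), of w w1 w2] that w by metis
  then show ?thesis using saturated good_recolour_0[OF c] w by blast
next
  case False
  show ?thesis
  proof (cases "\<exists>w\<in>U. E u w \<and> c w \<noteq> 0")
    case True
    then obtain w where w: "w \<in> U" "E u w" "c w \<noteq> 0" by blast
    show ?thesis
    proof (rule one_colour)
      show "c w \<in> {1, 2, 3}" using good_123[OF c w(1,3)] .
      show "c w \<noteq> c u" using good_adj[OF c u(1) w(1,2)] by simp
      show "c w' = 0 \<or> c w' = c w" if "w' \<in> U" "E u w'" for w'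
        using that w False by metis
    qed
  next
    case none: False
    obtain x :: nat where "x \<in> {1, 2, 3}" "x \<noteq> c u" using fresh_colour[of "c u" "c u"] by blast
    then show ?thesis using one_colour none by blast
  qed
qed

text \<open>The root lies in \<open>A\<close>, so \<open>c\<close> has to keep a nonzero colour
  there whenever one is demanded, while \<open>d\<close> may be renamed and even recoloured at
  \<open>v\<close>.\<close>

lemma good_join:
  assumes c: "good A c" and d: "good B d" and disj: "A \<inter> B = {}"
    and uv: "u \<in> A" "v \<in> B" "E u v"
    and unique: "\<And>x y. x \<in> A \<Longrightarrow> y \<in> B \<Longrightarrow> E x y \<Longrightarrow> x = u \<and> y = v"
    and dv: "d v \<noteq> 0" and cr: "r \<in> A" "low (A \<union> B) r \<Longrightarrow> c r \<noteq> 0"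
  shows "\<exists>e. good (A \<union> B) e \<and> (low (A \<union> B) r \<longrightarrow> e r \<noteq> 0)"
proof -
  have low_u: "low A u" using low_if_outer_nbr[of u v A] uv disj by blast
  have low_v: "low B v" using low_if_outer_nbr[of v u B] uv disj sym by blast
  have glue: "\<exists>e. good (A \<union> B) e \<and> (low (A \<union> B) r \<longrightarrow> e r \<noteq> 0)"
    if c': "good A c'" and d': "good B d'" and \<pi>: "\<pi> permutes {1, 2, 3}"
      and r: "low (A \<union> B) r \<Longrightarrow> c' r \<noteq> 0"
      and cond: "c' u \<noteq> \<pi> (d' v)" "\<And>w. w \<in> A \<Longrightarrow> E u w \<Longrightarrow> c' w \<noteq> \<pi> (d' v) \<or> \<pi> (d' v) = 0"
        "\<And>w. w \<in> B \<Longrightarrow> E v w \<Longrightarrow> \<pi> (d' w) \<noteq> c' u \<or> c' u = 0"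
    for c' d' \<pi>
  proof (intro exI conjI)
    show "good (A \<union> B) (\<lambda>x. if x \<in> A then c' x else \<pi> (d' x))"
    proof (rule good_union[OF c' good_permute[OF d' \<pi>] disj])
      fix x y x' y' assume "x \<in> A" "y \<in> B" "E x y" "x' \<in> A" "y' \<in> B" "E x' y'"
      then show "x = x' \<and> y = y'" using unique[of x y] unique[of x' y'] by simp
    next
      fix x y assume "x \<in> A" "y \<in> B" "E x y"
      then have xy: "x = u" "y = v" using unique[of x y] by simp_all
      show "c' x \<noteq> \<pi> (d' y) \<and> (\<forall>w\<in>A. E x w \<longrightarrow> c' w \<noteq> \<pi> (d' y) \<or> \<pi> (d' y) = 0) \<and>
        (\<forall>w\<in>B. E y w \<longrightarrow> \<pi> (d' w) \<noteq> c' x \<or> c' x = 0)"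
        unfolding xy using cond by simp
    qed
    show "low (A \<union> B) r \<longrightarrow> (if r \<in> A then c' r else \<pi> (d' r)) \<noteq> 0"
      using r cr by simp
  qed
  have zero: "\<exists>e. good (A \<union> B) e \<and> (low (A \<union> B) r \<longrightarrow> e r \<noteq> 0)"
    if c': "good A c'" "c' u = 0" and r: "low (A \<union> B) r \<Longrightarrow> c' r \<noteq> 0" for c'
  proof -
    obtain t where t: "t \<in> {1, 2, 3}" "\<And>w. w \<in> A \<Longrightarrow> E u w \<Longrightarrow> c' w \<noteq> t"
      using colour_avoiding_nbrs[OF low_u, of c'] by blast
    have "Transposition.transpose (d v) t permutes {1, 2, 3}"
      by (rule transpose_permutes_123[OF good_123[OF d uv(2) dv] t(1)])
    then show ?thesis
      by (rule glue[OF c'(1) d]) (use r t c' in auto)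
  qed
  show ?thesis
  proof (cases "c u = 0")
    case True
    then show ?thesis using zero c cr by blast
  next
    case False
    show ?thesis
    proof (cases rule: saturated_or_one_colour[OF c uv(1) low_u False])
      case 1
      then obtain w1 w2 where w: "w1 \<in> A" "w2 \<in> A" "E u w1" "E u w2" "w1 \<noteq> w2" by blast
      \<comment> \<open>Two neighbours in \<open>A\<close> and the neighbour \<open>v\<close> give
        degree \<open>3\<close>. If \<open>u\<close> is the root, the demand on its colour is
        void.\<close>
      have "\<not> low (A \<union> B) u"
        using not_low[of "A \<union> B" u w1 w2 v] w uv disj by blast
      then show ?thesis using zero[OF 1(1)] cr(2) by (metis fun_upd_apply)
    next
      case (2 x')
      note x' = 2
      show ?thesis
      proof (cases rule: saturated_or_one_colour[OF d uv(2) low_v dv])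
        case 1
        obtain t where t: "t \<in> {1, 2, 3}" "\<And>w. w \<in> B \<Longrightarrow> E v w \<Longrightarrow> d w \<noteq> t"
          using colour_avoiding_nbrs[OF low_v, of d] by blast
        \<comment> \<open>With \<open>v\<close> recoloured \<open>0\<close>, only its neighbours can
          clash with \<open>u\<close>. None of them has colour \<open>t\<close>, so renaming
          \<open>t\<close> to \<open>c u\<close> keeps \<open>c u\<close> away from them.\<close>
        let ?\<pi> = "Transposition.transpose t (c u)"
        have \<pi>: "?\<pi> permutes {1, 2, 3}"
          by (rule transpose_permutes_123[OF t(1) good_123[OF c uv(1) False]])
        have \<pi>0: "?\<pi> 0 = 0" using permutes_123(1)[OF \<pi>, of 0] by simp
        have ne: "?\<pi> s \<noteq> c u" if "s \<noteq> t" for s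
          using that by (metis transpose_apply_second transpose_involutory)
        show ?thesis
        proof (rule glue[OF c 1(1) \<pi>])
          fix w assume "w \<in> B" "E v w"
          moreover from this have "w \<noteq> v" using irrefl by blast
          ultimately show "?\<pi> ((d(v := 0)) w) \<noteq> c u \<or> c u = 0" using t(2) ne by simp
        qed (use \<pi>0 False cr in auto)
      next
        case (2 y')
        obtain \<pi> where \<pi>: "\<pi> permutes {1, 2, 3}" "\<pi> (d v) \<noteq> c u" "\<pi> (d v) \<noteq> x'" "\<pi> y' \<noteq> c u"
          using separating_permutation[OF good_123[OF c uv(1) False] x'(1) good_123[OF d uv(2) dv] 2(1)]
            x'(2) 2(2) by metis
        have \<pi>0: "\<pi> 0 = 0" using permutes_123(1)[OF \<pi>(1), of 0] by simp
        have \<pi>v: "\<pi> (d v) \<noteq> 0" using permutes_123(1)[OF \<pi>(1)] dv by simp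
        show ?thesis
        proof (rule glue[OF c d \<pi>(1) cr(2)])
          show "c u \<noteq> \<pi> (d v)" using \<pi>(2) by simp
          show "c w \<noteq> \<pi> (d v) \<or> \<pi> (d v) = 0" if "w \<in> A" "E u w" for w
            using x'(3)[OF that] \<pi>(3) \<pi>v by auto
          show "\<pi> (d w) \<noteq> c u \<or> c u = 0" if "w \<in> B" "E v w" for w
            using 2(3)[OF that] \<pi>(4) \<pi>0 False by auto
        qed simp
      qed
    qed
  qed
qed

section \<open>Extending a colouring to an ear\<close>

text \<open>The inner vertices \<open>p 1\<close> to \<open>p k\<close> have degree \<open>2\<close>
  in the enlarged graph; the adjacent ends stay in \<open>U\<close>. With \<open>k = 1\<close> the
  ear would close a triangle.\<close>

definition ear :: "'a set \<Rightarrow> (nat \<Rightarrow> 'a) \<Rightarrow> nat \<Rightarrow> bool" where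
  "ear U p k \<longleftrightarrow> 2 \<le> k \<and> inj_on p {0..Suc k} \<and> p 0 \<in> U \<and> p (Suc k) \<in> U \<and> (\<forall>i\<in>{1..k}. p i \<notin> U) \<and>
     E (p 0) (p (Suc k)) \<and> (\<forall>i\<le>k. E (p i) (p (Suc i))) \<and>
     (\<forall>i\<in>{1..k}. \<forall>x \<in> U \<union> p ` {1..k}. E (p i) x \<longrightarrow> x = p (i - 1) \<or> x = p (Suc i))"

text \<open>Makes the ends interchangeable, so that the extension from an end coloured
  \<open>0\<close> is proved for \<open>p 0\<close> only.\<close>

lemma ear_reverse:
  assumes "ear U p k"
  shows "ear U (\<lambda>i. p (Suc k - i)) k" and "(\<lambda>i. p (Suc k - i)) ` {1..k} = p ` {1..k}"
proof -
  let ?q = "\<lambda>i. p (Suc k - i)"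
  have p: "2 \<le> k" "inj_on p {0..Suc k}" "p 0 \<in> U" "p (Suc k) \<in> U" "\<And>i. i \<in> {1..k} \<Longrightarrow> p i \<notin> U"
    "E (p 0) (p (Suc k))" "\<And>i. i \<le> k \<Longrightarrow> E (p i) (p (Suc i))"
    "\<And>i x. i \<in> {1..k} \<Longrightarrow> x \<in> U \<union> p ` {1..k} \<Longrightarrow> E (p i) x \<Longrightarrow> x = p (i - 1) \<or> x = p (Suc i)"
    using assms unfolding ear_def by simp_all
  show img: "?q ` {1..k} = p ` {1..k}"
  proof
    show "p ` {1..k} \<subseteq> ?q ` {1..k}"
    proof
      fix x assume "x \<in> p ` {1..k}"
      then obtain i where i: "i \<in> {1..k}" "x = p i" by blast
      then have "x = ?q (Suc k - i)" "Suc k - i \<in> {1..k}" by auto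
      then show "x \<in> ?q ` {1..k}" by blast
    qed
  qed (auto intro!: imageI)
  show "ear U ?q k"
    unfolding ear_def img
  proof (intro conjI ballI allI impI)
    show "inj_on ?q {0..Suc k}"
    proof (rule inj_onI)
      fix i j assume ij: "i \<in> {0..Suc k}" "j \<in> {0..Suc k}" "?q i = ?q j"
      then have "Suc k - i = Suc k - j" using inj_onD[OF p(2) ij(3)] by simp
      then show "i = j" using ij by auto
    qed
    show "E (?q i) (?q (Suc i))" if "i \<le> k" for i
      using sym[OF p(7)[of "k - i"]] that by (simp add: Suc_diff_le)
    show "x = ?q (i - 1) \<or> x = ?q (Suc i)"
      if i: "i \<in> {1..k}" and x: "x \<in> U \<union> p ` {1..k}" "E (?q i) x" for i x
    proof -
      have "Suc (Suc k - i) = Suc k - (i - 1)" "Suc k - i - 1 = Suc k - Suc i" "Suc k - i \<in> {1..k}"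
        using i by auto
      then show ?thesis using p(8)[OF _ x] by metis
    qed
    show "?q i \<notin> U" if "i \<in> {1..k}" for i
    proof -
      have "Suc k - i \<in> {1..k}" using that by auto
      then show ?thesis by (rule p(5))
    qed
  qed (use p sym in auto)
qed

text \<open>Paths of length two between \<open>U\<close> and the inner vertices that have their
  middle in \<open>U\<close> run through an end: they join \<open>p 1\<close> to neighbours of
  \<open>p 0\<close>, or \<open>p k\<close> to neighbours of \<open>p (Suc k)\<close>. These are
  \<open>s1\<close> and \<open>sk\<close>; the rest is a condition along the path.\<close>

lemma ear_extend:
  assumes ear: "ear U p k" and c: "good U c"
    and ends: "s 0 = c (p 0)" "s (Suc k) = c (p (Suc k))"
    and s4: "\<And>i. s i < 4" and s: "proper_upto 0 (Suc k) s"
    and s1: "\<And>w. w \<in> U \<Longrightarrow> E (p 0) w \<Longrightarrow> s 1 \<noteq> c w \<or> s 1 = 0"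
    and sk: "\<And>w. w \<in> U \<Longrightarrow> E (p (Suc k)) w \<Longrightarrow> s k \<noteq> c w \<or> s k = 0"
  shows "\<exists>e. good (U \<union> p ` {1..k}) e \<and> (\<forall>x\<in>U. e x = c x)"
proof (intro exI conjI)
  let ?I = "p ` {1..k}"
  define e where "e = (\<lambda>x. if x \<in> U then c x else s (inv_into {0..Suc k} p x))"
  have p: "2 \<le> k" "inj_on p {0..Suc k}" "p 0 \<in> U" "p (Suc k) \<in> U" "\<And>i. i \<in> {1..k} \<Longrightarrow> p i \<notin> U"
    "\<And>i. i \<le> k \<Longrightarrow> E (p i) (p (Suc i))"
    "\<And>i x. i \<in> {1..k} \<Longrightarrow> x \<in> U \<union> ?I \<Longrightarrow> E (p i) x \<Longrightarrow> x = p (i - 1) \<or> x = p (Suc i)"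
    using ear unfolding ear_def by simp_all
  have e_U: "e x = c x" if "x \<in> U" for x using that by (simp add: e_def)
  have e_p: "e (p i) = s i" if "i \<le> Suc k" for i
  proof (cases "i = 0 \<or> i = Suc k")
    case True
    then show ?thesis using e_U p(3,4) ends by auto
  next
    case False
    then have "p i \<notin> U" using p(5)[of i] that by auto
    then show ?thesis using p(2) that by (simp add: e_def)
  qed
  have p_inj: "i = j" if "p i = p j" "i \<le> Suc k" "j \<le> Suc k" for i j
    using inj_onD[OF p(2) that(1)] that by simp
  have adj_inner: "e (p i) \<noteq> e x" if i: "i \<in> {1..k}" and x: "x \<in> U \<union> ?I" "E (p i) x" for i x
  proof -
    have "s (i - 1) \<noteq> s (Suc (i - 1))" "s i \<noteq> s (Suc i)"
      by (cases i; use s i in \<open>auto simp: proper_upto_def\<close>)+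
    then show ?thesis using p(7)[OF i x] e_p[of i] e_p[of "i - 1"] e_p[of "Suc i"] i by auto
  qed
  have dist_inner: "e (p i) \<noteq> e w \<or> e (p i) = 0"
    if i: "i \<in> {1..k}" and v: "v \<in> U" "E (p i) v" and w: "w \<in> U \<union> ?I" "E v w" "w \<noteq> p i" for i v w
  proof -
    consider "i = 1" "v = p 0" | "i = k" "v = p (Suc k)"
    proof -
      have "v = p (i - 1) \<or> v = p (Suc i)" using p(7)[OF i _ v(2)] v(1) by blast
      moreover have "i = 1" if "v = p (i - 1)"
      proof -
        have "i - 1 \<notin> {1..k}" using p(5)[of "i - 1"] v(1) that by metis
        then show ?thesis using i by auto
      qed
      moreover have "i = k" if "v = p (Suc i)"
      proof -
        have "Suc i \<notin> {1..k}" using p(5)[of "Suc i"] v(1) that by metis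
        then show ?thesis using i by auto
      qed
      ultimately show thesis using that by (metis diff_self_eq_0)
    qed
    then show ?thesis
    proof cases
      case 1
      show ?thesis
      proof (cases "w \<in> U")
        case True
        then show ?thesis using s1[of w] w 1 e_p[of 1] e_U by auto
      next
        case False
        then obtain j where j: "j \<in> {1..k}" "w = p j" using w(1) by blast
        \<comment> \<open>Inner vertices are adjacent only to their neighbours on the path, so an
          inner neighbour of \<open>p 0\<close> is \<open>p 1\<close>, which is \<open>p i\<close>
          itself.\<close>
        have "p 0 = p (j - 1) \<or> p 0 = p (Suc j)"
          using p(7)[OF j(1), of "p 0"] sym[OF w(2)] p(3) 1 j by auto
        moreover have "j - 1 \<le> Suc k" "Suc j \<le> Suc k" using j(1) by auto
        ultimately have "0 = j - 1 \<or> 0 = Suc j" using p_inj[OF _ le0] by blast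
        then have "j = 1" using j(1) by auto
        then show ?thesis using w(3) 1 j by simp
      qed
    next
      case 2
      show ?thesis
      proof (cases "w \<in> U")
        case True
        have "e (p i) = s k" using 2(1) e_p by simp
        moreover have "s k \<noteq> c w \<or> s k = 0" using sk[OF True] w(2) 2(2) by simp
        ultimately show ?thesis using e_U[OF True] by simp
      next
        case False
        then obtain j where j: "j \<in> {1..k}" "w = p j" using w(1) by blast
        have "p (Suc k) = p (j - 1) \<or> p (Suc k) = p (Suc j)"
          using p(7)[OF j(1), of "p (Suc k)"] sym[OF w(2)] p(4) 2(2) j(2) by simp
        moreover have "j - 1 \<le> Suc k" "Suc j \<le> Suc k" using j(1) by auto
        ultimately have "Suc k = j - 1 \<or> Suc k = Suc j" using p_inj[OF _ order_refl] by blast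
        then have "j = k" using j(1) by auto
        then show ?thesis using w(3) 2(1) j(2) by simp
      qed
    qed
  qed
  show "good (U \<union> ?I) e"
  proof (rule goodI)
    fix x assume "x \<in> U \<union> ?I"
    then show "e x < 4" using good_lt_4[OF c] s4 e_U e_p by (cases "x \<in> U") auto
  next
    fix x y assume xy: "x \<in> U \<union> ?I" "y \<in> U \<union> ?I" "E x y"
    consider "x \<in> U" "y \<in> U" | "x \<in> ?I" | "y \<in> ?I" using xy(1,2) by blast
    then show "e x \<noteq> e y"
    proof cases
      case 1
      then show ?thesis using good_adj[OF c _ _ xy(3)] e_U by simp
    next
      case 2
      then show ?thesis using adj_inner xy by blast
    next
      case 3
      then show ?thesis using adj_inner xy sym[OF xy(3)] by fastforce
    qed
  next
    fix x y z assume xyz: "x \<in> U \<union> ?I" "y \<in> U \<union> ?I" "z \<in> U \<union> ?I" "E x y" "E y z" "x \<noteq> z"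
    consider "x \<in> U" "y \<in> U" "z \<in> U" | "y \<in> ?I" | "x \<in> ?I" "y \<in> U" | "z \<in> ?I" "y \<in> U"
      using xyz(1-3) by blast
    then show "e x \<noteq> e z \<or> e x = 0"
    proof cases
      case 1
      then show ?thesis using good_dist2[OF c _ _ _ xyz(4-6)] e_U by simp
    next
      case 2
      then obtain i where i: "i \<in> {1..k}" "y = p i" by blast
      have "s (i - 1) \<noteq> s (Suc (Suc (i - 1))) \<or> s (i - 1) = 0"
        by (cases i) (use s i in \<open>auto simp: proper_upto_def\<close>)
      moreover have "x = p (i - 1) \<or> x = p (Suc i)" "z = p (i - 1) \<or> z = p (Suc i)"
        using p(7)[OF i(1) xyz(1)] p(7)[OF i(1) xyz(3)] sym[OF xyz(4)] xyz(5) i(2) by auto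
      moreover have "e (p (i - 1)) = s (i - 1)" "e (p (Suc i)) = s (Suc (Suc (i - 1)))"
        using e_p[of "i - 1"] e_p[of "Suc i"] i by auto
      ultimately show ?thesis using xyz(6) by auto
    next
      case 3
      then obtain i where i: "i \<in> {1..k}" "x = p i" by blast
      then show ?thesis using dist_inner[OF i(1) 3(2) _ xyz(3,5)] xyz(4,6) by auto
    next
      case 4
      then obtain i where i: "i \<in> {1..k}" "z = p i" by blast
      then show ?thesis using dist_inner[OF i(1) 4(2) _ xyz(1) sym[OF xyz(4)]] sym[OF xyz(5)] xyz(6) by auto
    qed
  qed
  show "\<forall>x\<in>U. e x = c x" using e_U by simp
qed

text \<open>At most two vertices of \<open>U\<close> are next to \<open>p 0\<close>, so some packing
  colour \<open>z\<close> is free for \<open>p 1\<close>; \<open>p k\<close> receives the exempt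
  colour \<open>0\<close>.\<close>

lemma ear_extend_0:
  assumes ear: "ear U p k" and c: "good U c" and low: "low U (p 0)" and 0: "c (p 0) = 0"
  shows "\<exists>e. good (U \<union> p ` {1..k}) e \<and> (\<forall>x\<in>U. e x = c x)"
proof -
  have p: "2 \<le> k" "p 0 \<in> U" "p (Suc k) \<in> U" "E (p 0) (p (Suc k))"
    using ear unfolding ear_def by simp_all
  have x: "c (p (Suc k)) \<noteq> 0" using good_adj[OF c p(2-4)] 0 by simp
  obtain z where z: "z \<in> {1, 2, 3}" "\<And>w. w \<in> U \<Longrightarrow> E (p 0) w \<Longrightarrow> c w \<noteq> z"
    using colour_avoiding_nbrs[OF low, of c] by blast
  obtain t where t: "t \<in> {1, 2, 3}" "t \<noteq> c (p (Suc k))" "t \<noteq> z" by (rule fresh_colour)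
  have "z \<noteq> t" "z \<noteq> 0" "t \<noteq> 0" "c (p (Suc k)) \<noteq> z" "c (p (Suc k)) \<noteq> t"
    using z t p by auto
  then obtain s where s: "s 0 = 0" "s 1 = z" "s k = 0" "s (Suc k) = c (p (Suc k))"
    "\<forall>i. s i \<in> {0, c (p (Suc k)), z, t}" "proper_upto 0 (Suc k) s"
    using colour_path_from_0[OF p(1), of z t "c (p (Suc k))"] x by metis
  have s4: "s i < 4" for i
    using s(5)[rule_format, of i] good_lt_4[OF c p(3)] z t by auto
  show ?thesis
  proof (rule ear_extend[OF ear c _ s(4) s4 s(6)])
    show "s 1 \<noteq> c w \<or> s 1 = 0" if "w \<in> U" "E (p 0) w" for w
      using z(2)[OF that] s(2) by simp
  qed (use s(1,3) 0 in simp_all)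
qed

text \<open>\<open>p 1\<close> gets the exempt colour \<open>0\<close>, so only the neighbours of
  \<open>p (Suc k)\<close> restrict the path. Apart from \<open>p 0\<close> they have colour
  \<open>0\<close>, and \<open>z\<close> differs from that and from the colour of
  \<open>p 0\<close>.\<close>

lemma ear_extend_nonzero:
  assumes ear: "ear U p k" and c: "good U c" and nz: "c (p 0) \<noteq> 0" "c (p (Suc k)) \<noteq> 0"
    and nbr: "\<And>w. w \<in> U \<Longrightarrow> E (p (Suc k)) w \<Longrightarrow> w \<noteq> p 0 \<Longrightarrow> c w = 0"
  shows "\<exists>e. good (U \<union> p ` {1..k}) e \<and> (\<forall>x\<in>U. e x = c x)"
proof -
  have p: "2 \<le> k" "p 0 \<in> U" "p (Suc k) \<in> U" "E (p 0) (p (Suc k))"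
    using ear unfolding ear_def by simp_all
  have xy: "c (p 0) \<noteq> c (p (Suc k))" using good_adj[OF c p(2-4)] .
  obtain z where z: "z \<in> {1, 2, 3}" "z \<noteq> c (p 0)" "z \<noteq> c (p (Suc k))" by (rule fresh_colour)
  then obtain s where s: "s 0 = c (p 0)" "s 1 = 0" "s k \<in> {0, z}" "s (Suc k) = c (p (Suc k))"
    "\<forall>i. s i \<in> {0, c (p 0), c (p (Suc k)), z}" "proper_upto 0 (Suc k) s"
    using colour_path_nonzero[OF p(1) xy, of z] nz by auto
  have s4: "s i < 4" for i
    using s(5)[rule_format, of i] good_lt_4[OF c p(2)] good_lt_4[OF c p(3)] z(1) by auto
  show ?thesis
  proof (rule ear_extend[OF ear c s(1,4) s4 s(6)])
    show "s k \<noteq> c w \<or> s k = 0" if "w \<in> U" "E (p (Suc k)) w" for w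
      using nbr[OF that] s(3) z(1,2) by (cases "w = p 0") auto
  qed (use s(2) in auto)
qed

lemma ear_colouring:
  assumes ear: "ear U p k" and c: "good U c" and r: "low (U \<union> p ` {1..k}) r \<Longrightarrow> c r \<noteq> 0" "r \<in> U"
  shows "\<exists>e. good (U \<union> p ` {1..k}) e \<and> (low (U \<union> p ` {1..k}) r \<longrightarrow> e r \<noteq> 0)"
proof -
  let ?I = "p ` {1..k}"
  have p: "2 \<le> k" "p 0 \<in> U" "p (Suc k) \<in> U" "E (p 0) (p (Suc k))" "p 1 \<notin> U" "p k \<notin> U"
    "E (p 0) (p 1)" "E (p k) (p (Suc k))" "p 1 \<in> ?I" "p k \<in> ?I"
    using ear unfolding ear_def by auto
  have low0: "low U (p 0)" using low_if_outer_nbr[OF p(7,5)] .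
  have low1: "low U (p (Suc k))" using low_if_outer_nbr[OF sym[OF p(8)] p(6)] .
  have start: "\<exists>e. good (U \<union> ?I) e \<and> (low (U \<union> ?I) r \<longrightarrow> e r \<noteq> 0)"
    if "good U c'" "c' (p 0) = 0" "low (U \<union> ?I) r \<Longrightarrow> c' r \<noteq> 0" for c'
    using ear_extend_0[OF ear that(1) low0 that(2)] that(3) r(2) by metis
  have finish: "\<exists>e. good (U \<union> ?I) e \<and> (low (U \<union> ?I) r \<longrightarrow> e r \<noteq> 0)"
    if "good U c'" "c' (p (Suc k)) = 0" "low (U \<union> ?I) r \<Longrightarrow> c' r \<noteq> 0" for c'
    using ear_extend_0[OF ear_reverse(1)[OF ear] that(1)] low1 that(2,3) r(2)
    unfolding ear_reverse(2)[OF ear] by (simp; metis)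
  \<comment> \<open>\<open>v\<close> and \<open>w\<close> are all the neighbours of \<open>u\<close>
    in \<open>U\<close>, so \<open>u\<close> may become \<open>0\<close>. With \<open>q\<close> on
    the ear, \<open>u\<close> has degree \<open>3\<close>; should it be the root, no demand is
    left.\<close>
  have recolour: "good U (c(u := 0))" "low (U \<union> ?I) r \<Longrightarrow> (c(u := 0)) r \<noteq> 0"
    if "low U u" "E u v" "v \<in> U" "c v \<noteq> 0" "E u w" "w \<in> U" "w \<noteq> v" "c w \<noteq> 0" "E u q" "q \<in> ?I" "q \<notin> U"
    for u v w q
  proof -
    have "c x \<noteq> 0" if "x \<in> U" "E u x" for x
      using not_low[OF \<open>low U u\<close> that(2) \<open>E u v\<close> \<open>E u w\<close> that(1)] \<open>v \<in> U\<close> \<open>w \<in> U\<close> \<open>w \<noteq> v\<close>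
        \<open>c v \<noteq> 0\<close> \<open>c w \<noteq> 0\<close> by metis
    then show "good U (c(u := 0))" by (rule good_recolour_0[OF c])
    have "\<not> low (U \<union> ?I) u"
      using not_low[of "U \<union> ?I" u v w q] that by blast
    then show "(c(u := 0)) r \<noteq> 0" if "low (U \<union> ?I) r" using r(1)[OF that] that by auto
  qed
  \<comment> \<open>Recolouring an end that has a second nonzero neighbour in \<open>U\<close>
    reduces \<open>sat0\<close> and \<open>sat1\<close> to the cases of an end coloured
    \<open>0\<close>.\<close>
  consider (z0) "c (p 0) = 0" | (z1) "c (p (Suc k)) = 0"
    | (sat0) w where "c (p (Suc k)) \<noteq> 0" "w \<in> U" "E (p 0) w" "w \<noteq> p (Suc k)" "c w \<noteq> 0"
    | (sat1) w where "c (p 0) \<noteq> 0" "w \<in> U" "E (p (Suc k)) w" "w \<noteq> p 0" "c w \<noteq> 0"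
    | (nz) "c (p 0) \<noteq> 0" "c (p (Suc k)) \<noteq> 0" "\<And>w. w \<in> U \<Longrightarrow> E (p (Suc k)) w \<Longrightarrow> w \<noteq> p 0 \<Longrightarrow> c w = 0"
    by metis
  then show ?thesis
  proof cases
    case z0
    then show ?thesis using start[OF c] r(1) by blast
  next
    case z1
    then show ?thesis using finish[OF c] r(1) by blast
  next
    case sat0
    note new = recolour[OF low0 p(4,3) sat0(1,3,2,4,5) p(7,9,5)]
    show ?thesis by (rule start[OF new(1)]) (use new(2) in auto)
  next
    case sat1
    note new = recolour[OF low1 sym[OF p(4)] p(2) sat1(1,3,2,4,5) sym[OF p(8)] p(10,6)]
    show ?thesis by (rule finish[OF new(1)]) (use new(2) in auto)
  next
    case nz
    then obtain e where "good (U \<union> ?I) e" "\<forall>x\<in>U. e x = c x"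
      using ear_extend_nonzero[OF ear c] by blast
    then show ?thesis using r by auto
  qed
qed

section \<open>Hamiltonian cycles and their chords\<close>

text \<open>A list of two adjacent vertices counts as a cycle, which runs along one edge and back;
  the search for a longest cycle starts from such a list.\<close>

definition cyclic_list :: "'a list \<Rightarrow> bool" where
  "cyclic_list vs \<longleftrightarrow> vs \<noteq> [] \<and> distinct vs \<and> successively E (vs @ [hd vs])"

text \<open>Both pairs are directed out of \<open>A\<close>, so different pairs are different edges.
  Cuts without edges are excluded too, so connectedness is included.\<close>

definition two_edge_connected :: "'a set \<Rightarrow> bool" where
  "two_edge_connected U \<longleftrightarrow> (\<forall>A. A \<noteq> {} \<longrightarrow> A \<subset> U \<longrightarrow>
     (\<exists>u\<in>A. \<exists>v\<in>U - A. \<exists>u'\<in>A. \<exists>v'\<in>U - A. E u v \<and> E u' v' \<and> (u, v) \<noteq> (u', v')))"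

lemma two_edge_connectedD:
  assumes "two_edge_connected U" "A \<noteq> {}" "A \<subset> U"
  obtains u v where "u \<in> A" "v \<in> U - A" "E u v" "(u, v) \<noteq> e"
  using assms unfolding two_edge_connected_def by metis

lemma cyclic_list_rotate:
  assumes "cyclic_list (xs @ ys)"
  shows "cyclic_list (ys @ xs)"
proof (cases "xs = [] \<or> ys = []")
  case True
  then show ?thesis using assms by auto
next
  case False
  then show ?thesis using assms unfolding cyclic_list_def by (auto simp: successively_append_iff)
qed

lemma successively_rev_E [simp]: "successively (\<lambda>x y. E y x) xs \<longleftrightarrow> successively E xs"
proof -
  have "(\<lambda>x y. E y x) = E" using sym by blast
  then show ?thesis by (rule arg_cong[where f = "\<lambda>P. successively P xs"])
qed

lemma path_within:
  assumes "(\<lambda>x y. E x y \<and> y \<in> S)\<^sup>*\<^sup>* q y" "q \<in> S"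
  shows "\<exists>R. R \<noteq> [] \<and> distinct R \<and> hd R = q \<and> last R = y \<and> set R \<subseteq> S \<and> successively E R"
  using assms(1)
proof induction
  case base
  then show ?case using assms(2) by (intro exI[of _ "[q]"]) simp
next
  case (step y z)
  then obtain R where R: "R \<noteq> []" "distinct R" "hd R = q" "last R = y" "set R \<subseteq> S" "successively E R"
    by blast
  show ?case
  proof (cases "z \<in> set R")
    case True
    then obtain X Y where XY: "R = X @ z # Y" by (meson split_list)
    then show ?thesis using R
      by (intro exI[of _ "X @ [z]"]) (auto simp: successively_append_iff hd_append split: if_splits)
  next
    case False
    then show ?thesis using R step.hyps
      by (intro exI[of _ "R @ [z]"]) (auto simp: successively_append_iff)
  qed
qed

text \<open>\<open>u\<close> and \<open>w\<close> split the cycle into two arcs. If both have inner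
  vertices, they form a theta with \<open>R\<close>; otherwise \<open>u\<close> and \<open>w\<close>
  are consecutive and \<open>R\<close> replaces the edge between them.\<close>

lemma cyclic_list_ear:
  assumes cyc: "cyclic_list (u # ys)" and w: "w \<in> set ys"
    and R: "R \<noteq> []" "distinct R" "set R \<inter> set (u # ys) = {}" "successively E R"
    and ends: "E u (hd R)" "E (last R) w"
  shows "\<exists>vs. cyclic_list vs \<and> length (u # ys) < length vs \<and> set vs \<subseteq> set (u # ys) \<union> set R"
proof -
  obtain P Q where ys: "ys = P @ w # Q" using w by (meson split_list)
  note walk = cyc[unfolded cyclic_list_def ys]
  consider "P = []" | "Q = []" | "P \<noteq> []" "Q \<noteq> []" by blast
  then show ?thesis
  proof cases
    case 1
    have "cyclic_list (u # R @ w # Q)"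
      using walk R ends 1 unfolding cyclic_list_def ys by (auto simp: successively_append_iff successively_Cons)
    then show ?thesis using 1 R(1) ys by (intro exI[of _ "u # R @ w # Q"]) auto
  next
    case 2
    have "cyclic_list (u # P @ w # rev R)"
      using walk R ends 2 sym unfolding cyclic_list_def ys
      by (auto simp: successively_append_iff successively_Cons hd_rev last_rev hd_append)
    then show ?thesis using 2 R(1) ys by (intro exI[of _ "u # P @ w # rev R"]) auto
  next
    case 3
    have "theta_subgraph E"
      unfolding theta_subgraph_def
    proof (intro exI conjI)
      show "successively E (u # P @ [w])"
        using walk by (auto simp: successively_append_iff successively_Cons hd_append)
      show "successively E (u # rev Q @ [w])"
        using walk sym 3 by (auto simp: successively_append_iff successively_Cons hd_rev last_rev)
      show "successively E (u # R @ [w])"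
        using R ends by (auto simp: successively_append_iff successively_Cons)
      show "distinct (u # w # P @ rev Q @ R)" using walk R(2,3) ys by auto
    qed (use 3 R in auto)
    then show ?thesis using no_theta by blast
  qed
qed

text \<open>If a longest cycle misses a vertex, one edge leads from it to a component of the rest
  and a second edge leads back. The resulting detour gives a longer cycle, a theta, or a vertex with
  four neighbours.\<close>

lemma hamiltonian_cycle:
  assumes fin: "finite U" and conn: "two_edge_connected U" and u0: "u0 \<in> U" "U \<noteq> {u0}"
  shows "\<exists>vs. cyclic_list vs \<and> set vs = U"
proof -
  have "{u0} \<subset> U" using u0 by blast
  \<comment> \<open>\<open>(u0, u0)\<close> is no edge, so excluding it is a mere
    placeholder.\<close>
  then obtain a v0 where "a \<in> {u0}" "v0 \<in> U - {u0}" "E a v0" "(a, v0) \<noteq> (u0, u0)"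
    by (rule two_edge_connectedD[OF conn insert_not_empty])
  then have v0: "v0 \<in> U" "E u0 v0" by auto
  let ?P = "\<lambda>vs. cyclic_list vs \<and> set vs \<subseteq> U"
  have "u0 \<noteq> v0" using v0 irrefl by blast
  then have init: "?P [u0, v0]" using v0 u0 sym by (auto simp: cyclic_list_def)
  have "length vs < Suc (card U)" if "?P vs" for vs
    using that card_mono[OF fin, of "set vs"] distinct_card[of vs] by (simp add: cyclic_list_def)
  then have bound: "\<forall>vs. ?P vs \<longrightarrow> length vs < Suc (card U)" by blast
  obtain vs where vs: "cyclic_list vs" "set vs \<subseteq> U" and max: "\<And>ws. ?P ws \<Longrightarrow> length ws \<le> length vs"
    using ex_has_greatest_nat[of ?P, OF init bound] by blast
  have "set vs = U"
  proof (rule ccontr)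
    assume "set vs \<noteq> U"
    then have "set vs \<subset> U" "set vs \<noteq> {}" using vs by (auto simp: cyclic_list_def)
    then obtain u q where uq: "u \<in> set vs" "q \<in> U - set vs" "E u q"
      using two_edge_connectedD[OF conn, of "set vs"] by blast
    obtain xs zs where xz: "vs = xs @ u # zs" using uq(1) by (meson split_list)
    define ys where "ys = zs @ xs"
    have cyc: "cyclic_list (u # ys)" using cyclic_list_rotate[of xs "u # zs"] vs(1) xz by (simp add: ys_def)
    have ys: "set (u # ys) = set vs" "length (u # ys) = length vs" using xz by (auto simp: ys_def)
    have "2 \<le> length vs" using max[OF init] by simp
    then have "ys \<noteq> []" using ys(2) by auto
    let ?r = "\<lambda>x y. E x y \<and> y \<in> U - set vs"
    \<comment> \<open>The component of \<open>q\<close> off the cycle. An edge leaving it ends on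
      the cycle, and the cut condition supplies one other than the edge from \<open>q\<close> to
      \<open>u\<close>.\<close>
    define A where "A = {y \<in> U - set vs. ?r\<^sup>*\<^sup>* q y}"
    have "A \<noteq> {}" "A \<subset> U" using uq vs(2) by (auto simp: A_def)
    then obtain q' w where qw: "q' \<in> A" "w \<in> U - A" "E q' w" "(q', w) \<noteq> (q, u)"
      by (rule two_edge_connectedD[OF conn])
    have w: "w \<in> set vs"
    proof (rule ccontr)
      assume "w \<notin> set vs"
      then have "?r q' w" using qw by blast
      then have "?r\<^sup>*\<^sup>* q w" using qw(1) unfolding A_def by (auto intro: rtranclp.rtrancl_into_rtrancl)
      then show False using qw(2) \<open>w \<notin> set vs\<close> unfolding A_def by blast
    qed
    have "?r\<^sup>*\<^sup>* q q'" using qw(1) by (simp add: A_def)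
    from path_within[OF this uq(2)] obtain R where R: "R \<noteq> []" "distinct R" "hd R = q" "last R = q'"
      "set R \<subseteq> U - set vs" "successively E R" by blast
    have "\<exists>ws. cyclic_list ws \<and> length (u # ys) < length ws \<and> set ws \<subseteq> set (u # ys) \<union> set R"
    proof (cases "w = u")
      case False
      have "w \<in> set ys" using w ys(1) False by auto
      moreover have "set R \<inter> set (u # ys) = {}" using R(5) ys(1) by auto
      ultimately show ?thesis using cyclic_list_ear[OF cyc _ R(1,2) _ R(6)] R(3,4) uq(3) qw(3) by blast
    next
      \<comment> \<open>\<open>u\<close> has two neighbours \<open>q\<close> and \<open>q'\<close>
        off the cycle, so degree \<open>3\<close> leaves room for one neighbour on it. The cycle is
        then the degenerate one with two vertices, and \<open>u # R\<close> is longer.\<close>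
      case True
      then have "q' \<noteq> q" using qw(4) by blast
      have "u \<notin> set R" using R(5) uq(1) by blast
      have "cyclic_list (u # R)"
        using R True uq(3) qw(3) \<open>u \<notin> set R\<close> unfolding cyclic_list_def
        by (auto simp: successively_append_iff successively_Cons)
      moreover have "2 \<le> length R"
        using R(1,3,4) \<open>q' \<noteq> q\<close> by (cases R; cases "tl R") auto
      moreover have "length ys = 1"
      proof (rule ccontr)
        assume "length ys \<noteq> 1"
        then obtain y ys' where y: "ys = y # ys'" "ys' \<noteq> []" using \<open>ys \<noteq> []\<close> by (cases ys) auto
        moreover have "distinct ys" using cyc by (simp add: cyclic_list_def)
        ultimately have "hd ys \<noteq> last ys" by auto
        have "set ys \<subseteq> set vs" unfolding ys(1)[symmetric] by (rule set_subset_Cons)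
        then have "hd ys \<in> set vs" "last ys \<in> set vs"
          using hd_in_set[OF \<open>ys \<noteq> []\<close>] last_in_set[OF \<open>ys \<noteq> []\<close>] by blast+
        moreover have "q \<notin> set vs" "q' \<notin> set vs" using uq qw(1) by (auto simp: A_def)
        ultimately have "distinct [hd ys, last ys, q, q']"
          using \<open>hd ys \<noteq> last ys\<close> \<open>q' \<noteq> q\<close> by auto
        moreover have "E u (hd ys)" "E (last ys) u"
          using cyc \<open>ys \<noteq> []\<close> by (auto simp: cyclic_list_def successively_append_iff successively_Cons)
        ultimately show False
          using no_four_nbrs[of u "hd ys" "last ys" q q'] uq(3) qw(3) True sym by blast
      qed
      ultimately show ?thesis by (intro exI[of _ "u # R"]) auto
    qed
    then obtain ws where ws: "cyclic_list ws" "length vs < length ws" "set ws \<subseteq> set vs \<union> set R"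
      unfolding ys by blast
    moreover have "set ws \<subseteq> U" using ws(3) vs(2) R(5) by blast
    ultimately show False using max[of ws] by simp
  qed
  then show ?thesis using vs(1) by blast
qed

section \<open>Non-crossing chords and the ear below a shortest chord\<close>

lemma successively_infix: "successively P (xs @ ys @ zs) \<Longrightarrow> successively P ys"
  by (simp add: successively_append_iff)

text \<open>Two crossing chords form, with the cycle, a subdivision of \<open>K\<^sub>4\<close>; it contains a forbidden theta
  since some edge of a triangle of the \<open>K\<^sub>4\<close> is subdivided.\<close>

lemma no_crossing_chords:
  assumes cyc: "cyclic_list (a # P @ b # Q @ c # R @ d # S)" and chords: "E a c" "E b d"
  shows False
proof -
  have dist: "distinct (a # P @ b # Q @ c # R @ d # S)"
    and walk: "successively E (a # P @ b # Q @ c # R @ d # S @ [a])"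
    using cyc by (simp_all add: cyclic_list_def)
  have P: "successively E (a # P @ [b])"
    using successively_infix[of E "[]" "a # P @ [b]" "Q @ c # R @ d # S @ [a]"] walk by simp
  have Q: "successively E (b # Q @ [c])"
    using successively_infix[of E "a # P" "b # Q @ [c]" "R @ d # S @ [a]"] walk by simp
  have R: "successively E (c # R @ [d])"
    using successively_infix[of E "a # P @ b # Q" "c # R @ [d]" "S @ [a]"] walk by simp
  have S: "successively E (d # S @ [a])"
    using successively_infix[of E "a # P @ b # Q @ c # R" "d # S @ [a]" "[]"] walk by simp
  have revs: "successively E (c # rev Q @ [b])" "successively E (d # rev R @ [c])"
    "successively E (a # rev S @ [d])"
    using Q R S successively_rev[of E "b # Q @ [c]"] successively_rev[of E "c # R @ [d]"]
      successively_rev[of E "d # S @ [a]"] by simp_all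
  have chords': "E c a" "E d b" using chords sym by blast+
  have "theta_subgraph E"
  proof (cases "P = []")
    case False
    show ?thesis unfolding theta_subgraph_def
    proof (intro exI conjI)
      show "successively E (a # P @ [b])" by (rule P)
      show "successively E (a # (c # rev Q) @ [b])" using revs(1) chords(1) by simp
      show "successively E (a # (rev S @ [d]) @ [b])"
        using revs(3) chords'(2) successively_append_iff[of E "a # rev S @ [d]" "[b]"] by simp
      show "distinct (a # b # P @ (c # rev Q) @ (rev S @ [d]))" using dist by auto
    qed (use False in auto)
  next
    case True
    have "Q \<noteq> []"
    proof
      assume "Q = []"
      then show False using P Q True no_triangle[of a b c] chords' by simp
    qed
    show ?thesis unfolding theta_subgraph_def
    proof (intro exI conjI)
      show "successively E (b # Q @ [c])" by (rule Q)
      show "successively E (b # [a] @ [c])" using P True chords sym by simp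
      show "successively E (b # (d # rev R) @ [c])" using revs(2) chords(2) by simp
      show "distinct (b # c # Q @ [a] @ (d # rev R))" using dist by auto
    qed (use \<open>Q \<noteq> []\<close> in auto)
  qed
  then show False using no_theta by blast
qed

lemma drop_split: "m \<le> j \<Longrightarrow> j < length vs \<Longrightarrow> \<exists>P. drop m vs = P @ vs ! j # drop (Suc j) vs"
  using id_take_nth_drop[of "j - m" "drop m vs"] by (intro exI[of _ "take (j - m) (drop m vs)"]) simp

lemma no_crossing_chords_nth:
  assumes cyc: "cyclic_list vs" and idx: "i < j" "j < k" "k < l" "l < length vs"
    and chords: "E (vs ! i) (vs ! k)" "E (vs ! j) (vs ! l)"
  shows False
proof -
  obtain X P Q R where "drop 0 vs = X @ vs ! i # drop (Suc i) vs"
    "drop (Suc i) vs = P @ vs ! j # drop (Suc j) vs" "drop (Suc j) vs = Q @ vs ! k # drop (Suc k) vs"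
    "drop (Suc k) vs = R @ vs ! l # drop (Suc l) vs"
    using drop_split[of 0 i vs] drop_split[of "Suc i" j vs] drop_split[of "Suc j" k vs]
      drop_split[of "Suc k" l vs] idx by auto
  then have "vs = X @ vs ! i # P @ vs ! j # Q @ vs ! k # R @ vs ! l # drop (Suc l) vs" by simp
  then have "cyclic_list (vs ! i # P @ vs ! j # Q @ vs ! k # R @ vs ! l # drop (Suc l) vs @ X)"
    using cyclic_list_rotate[of X "vs ! i # P @ vs ! j # Q @ vs ! k # R @ vs ! l # drop (Suc l) vs"] cyc by simp
  then show False using no_crossing_chords chords by blast
qed

text \<open>The edge from the last vertex to the first counts as a chord here, so a candidate always
  exists. The ear's inner vertices have positions strictly between \<open>i\<close> and
  \<open>j\<close>, hence never position \<open>0\<close>; this is how a root placed at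
  \<open>hd vs\<close> survives.\<close>

lemma cyclic_list_has_ear:
  assumes cyc: "cyclic_list vs" and len: "3 \<le> length vs"
  shows "\<exists>p k. ear (set vs - p ` {1..k}) p k \<and> p ` {1..k} \<subseteq> set vs \<and> hd vs \<notin> p ` {1..k}"
proof -
  let ?n = "length vs"
  have dist: "distinct vs" and ne: "vs \<noteq> []" using cyc by (simp_all add: cyclic_list_def)
  have step: "E (vs ! i) (vs ! Suc i)" if "Suc i < ?n" for i
    using cyc that unfolding cyclic_list_def successively_append_iff by (simp add: successively_nth)
  have close: "E (vs ! 0) (vs ! (?n - 1))"
    using cyc ne sym by (auto simp: cyclic_list_def successively_append_iff last_conv_nth hd_conv_nth)
  let ?C = "\<lambda>(i, j). i + 2 \<le> j \<and> j < ?n \<and> E (vs ! i) (vs ! j)"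
  have "?C (0, ?n - 1)" using close len by auto
  from ex_has_least_nat[of ?C, OF this, of "\<lambda>(i, j). j - i"]
  obtain i j where ij: "i + 2 \<le> j" "j < ?n" "E (vs ! i) (vs ! j)"
    and min: "\<And>i' j'. i' + 2 \<le> j' \<Longrightarrow> j' < ?n \<Longrightarrow> E (vs ! i') (vs ! j') \<Longrightarrow> j - i \<le> j' - i'"
    by fastforce
  define k where "k = j - i - 1"
  define p where "p = (\<lambda>m. vs ! (i + m))"
  let ?I = "p ` {1..k}"
  have ends: "p 0 = vs ! i" "p (Suc k) = vs ! j" using ij by (simp_all add: p_def k_def)
  have idx: "i + m < ?n" if "m \<le> Suc k" for m using that ij by (simp add: k_def)
  have inj: "inj_on p {0..Suc k}"
    using dist idx by (auto simp: inj_on_def p_def nth_eq_iff_index_eq)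
  have not_inner: "p m \<notin> ?I" if "m = 0 \<or> m = Suc k" for m
  proof
    assume "p m \<in> ?I"
    then obtain l where "l \<in> {1..k}" "p m = p l" by blast
    then show False using inj_onD[OF inj, of m l] that by auto
  qed
  have sub: "?I \<subseteq> set vs" using idx by (auto simp: p_def)
  have "ear (set vs - ?I) p k"
    unfolding ear_def
  proof (intro conjI ballI allI impI)
    \<comment> \<open>For \<open>k = 1\<close> the chord and two edges of the cycle form a
      triangle.\<close>
    show "2 \<le> k"
    proof (rule ccontr)
      assume "\<not> 2 \<le> k"
      then have "j = Suc (Suc i)" using ij by (simp add: k_def)
      then show False using no_triangle[OF step step, of i] ij sym by auto
    qed
    show "p 0 \<in> set vs - ?I" "p (Suc k) \<in> set vs - ?I"
      using not_inner ij using not_inner[of 0] not_inner[of "Suc k"] ij ends by simp_all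
    show "E (p 0) (p (Suc k))" unfolding ends by (rule ij)
    show "E (p m) (p (Suc m))" if "m \<le> k" for m
      using step[of "i + m"] idx[of "Suc m"] that by (simp add: p_def)
    show "x = p (m - 1) \<or> x = p (Suc m)"
      if m: "m \<in> {1..k}" and x: "x \<in> set vs - ?I \<union> ?I" "E (p m) x" for m x
    proof -
      obtain l where l: "l < ?n" "x = vs ! l" using x(1) sub by (metis Diff_partition in_set_conv_nth sup_commute)
      let ?m = "i + m"
      have mj: "i < ?m" "?m < j" using m by (auto simp: k_def)
      have E: "E (vs ! ?m) (vs ! l)" "E (vs ! l) (vs ! ?m)" using x(2) l(2) sym by (auto simp: p_def)
      \<comment> \<open>A neighbour outside the range from \<open>i\<close> to \<open>j\<close>
        gives a chord crossing the shortest one; a neighbour inside it that is not consecutive gives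
        a shorter chord.\<close>
      have "\<not> l < i"
        using no_crossing_chords_nth[OF cyc, of l i ?m j] mj ij E by blast
      moreover have "\<not> j < l"
        using no_crossing_chords_nth[OF cyc, of i ?m j l] mj ij E l(1) by blast
      moreover have "\<not> l + 2 \<le> ?m" if "i \<le> l"
        using min[of l ?m] mj ij E that by auto
      moreover have "\<not> ?m + 2 \<le> l" if "l \<le> j"
        using min[of ?m l] mj ij E that by auto
      moreover have "l \<noteq> ?m" using E irrefl by metis
      ultimately have "l = ?m - 1 \<or> l = Suc ?m" by linarith
      then show ?thesis using l(2) m by (auto simp: p_def)
    qed
  qed (use inj in auto)
  moreover have "hd vs \<notin> ?I"
  proof
    assume "hd vs \<in> ?I"
    then obtain m where "m \<in> {1..k}" "vs ! 0 = vs ! (i + m)" using ne by (auto simp: p_def hd_conv_nth)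
    then show False using dist idx[of m] ne by (auto simp: nth_eq_iff_index_eq)
  qed
  ultimately show ?thesis using sub by blast
qed

section \<open>Induction over induced subgraphs\<close>

lemma good_singleton: "good {x} (\<lambda>_. 1)"
  by (rule goodI) (use irrefl in auto)

theorem rooted_good_colouring:
  assumes "finite U" "r \<in> U"
  shows "\<exists>c. good U c \<and> (low U r \<longrightarrow> c r \<noteq> 0)"
  using assms
proof (induction U arbitrary: r rule: finite_psubset_induct)
  case (psubset U)
  note IH = psubset.IH
  consider "U = {r}" | "\<not> two_edge_connected U" | "two_edge_connected U" "U \<noteq> {r}" by blast
  then show ?case
  proof cases
    case 1
    \<comment> \<open>The colour is \<open>1\<close> and not \<open>0\<close>, since a root without
      neighbours is low.\<close>
    then show ?thesis using good_singleton[of r] by auto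
  next
    case 2
    \<comment> \<open>\<open>A\<close> is the side of the given root; \<open>B\<close> is rooted
      afresh at its end of the cut edge, if there is one.\<close>
    have cut: "\<exists>c. good U c \<and> (low U r \<longrightarrow> c r \<noteq> 0)"
      if AB: "A \<union> B = U" "A \<inter> B = {}" "B \<noteq> {}" and r: "r \<in> A"
        and unique: "\<And>x y x' y'. x \<in> A \<Longrightarrow> y \<in> B \<Longrightarrow> E x y \<Longrightarrow> x' \<in> A \<Longrightarrow> y' \<in> B \<Longrightarrow> E x' y' \<Longrightarrow> x = x' \<and> y = y'"
      for A B
    proof -
      have "A \<subset> U" "B \<subset> U" using AB r by auto
      obtain c where c: "good A c" "low A r \<Longrightarrow> c r \<noteq> 0" using IH[OF \<open>A \<subset> U\<close> r] by blast
      have cr: "low (A \<union> B) r \<Longrightarrow> c r \<noteq> 0" using c(2) low_mono[of "A \<union> B" r A] by blast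
      show ?thesis
      proof (cases "\<exists>u\<in>A. \<exists>v\<in>B. E u v")
        case True
        then obtain u v where uv: "u \<in> A" "v \<in> B" "E u v" by blast
        have "low B v" using low_if_outer_nbr[OF sym[OF uv(3)]] uv(1) AB(2) by blast
        then obtain d where d: "good B d" "d v \<noteq> 0" using IH[OF \<open>B \<subset> U\<close> uv(2)] by blast
        show ?thesis
          using good_join[OF c(1) d(1) AB(2) uv _ d(2) r cr] unique[OF _ _ _ uv] unfolding AB(1) by blast
      next
        case False
        obtain v where "v \<in> B" using AB(3) by blast
        then obtain d where d: "good B d" using IH[OF \<open>B \<subset> U\<close>] by blast
        have "good (A \<union> B) (\<lambda>x. if x \<in> A then c x else d x)"
          by (rule good_union[OF c(1) d AB(2)]) (use False in blast)+
        then show ?thesis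
          using cr r unfolding AB(1) by (intro exI[of _ "\<lambda>x. if x \<in> A then c x else d x"]) simp
      qed
    qed
    from 2 obtain A where A: "A \<noteq> {}" "A \<subset> U"
      and unique: "\<And>x y x' y'. x \<in> A \<Longrightarrow> y \<in> U - A \<Longrightarrow> E x y \<Longrightarrow> x' \<in> A \<Longrightarrow> y' \<in> U - A \<Longrightarrow> E x' y' \<Longrightarrow> x = x' \<and> y = y'"
      unfolding two_edge_connected_def by (metis prod.inject)
    show ?thesis
    proof (cases "r \<in> A")
      case True
      show ?thesis by (rule cut[of A "U - A"]) (use A True unique in auto)
    next
      case False
      show ?thesis
      proof (rule cut[of "U - A" A])
        fix x y x' y' assume "x \<in> U - A" "y \<in> A" "E x y" "x' \<in> U - A" "y' \<in> A" "E x' y'"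
        then show "x = x' \<and> y = y'" using unique[of y x y' x'] sym by blast
      qed (use A False psubset.prems in auto)
    qed
  next
    case 3
    obtain vs where vs: "cyclic_list vs" "set vs = U"
      using hamiltonian_cycle[OF psubset.hyps(1) 3(1) psubset.prems 3(2)] by blast
    obtain xs ys where xy: "vs = xs @ r # ys" using psubset.prems vs(2) by (metis split_list)
    \<comment> \<open>The cycle is turned to start at the root, because the head of the list is
      never an inner vertex of the ear found below.\<close>
    define ws where "ws = r # ys @ xs"
    have ws: "cyclic_list ws" "set ws = U" "hd ws = r"
      using cyclic_list_rotate[of xs "r # ys"] vs xy by (auto simp: ws_def)
    have "3 \<le> length ws"
    proof (rule ccontr)
      assume "\<not> 3 \<le> length ws"
      then have "length (ys @ xs) \<le> 1" by (simp add: ws_def)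
      then consider "ys @ xs = []" | v where "ys @ xs = [v]"
        by (cases "ys @ xs") auto
      then show False
      proof cases
        case 1
        then show False using ws(2) 3(2) by (simp add: ws_def)
      next
        case (2 v)
        then have "U = {r, v}" using ws(2) by (auto simp: ws_def)
        then have "{r} \<subset> U" using 3(2) by blast
        \<comment> \<open>Two vertices carry only one edge, so the second edge of the cut
          \<open>{r}\<close> cannot exist.\<close>
        then obtain a b where "a \<in> {r}" "b \<in> U - {r}" "E a b" "(a, b) \<noteq> (r, v)"
          by (rule two_edge_connectedD[OF 3(1) insert_not_empty])
        then show False using \<open>U = {r, v}\<close> by blast
      qed
    qed
    then obtain p k where ear: "ear (U - p ` {1..k}) p k" and sub: "p ` {1..k} \<subseteq> U" and r: "r \<notin> p ` {1..k}"
      using cyclic_list_has_ear[OF ws(1)] ws(2,3) by auto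
    let ?V = "U - p ` {1..k}"
    have "p ` {1..k} \<noteq> {}" using ear unfolding ear_def by auto
    then have "?V \<subset> U" using sub by blast
    have rV: "r \<in> ?V" using r psubset.prems by blast
    obtain c where c: "good ?V c" "low ?V r \<Longrightarrow> c r \<noteq> 0" using IH[OF \<open>?V \<subset> U\<close> rV] by blast
    have eq: "?V \<union> p ` {1..k} = U" using sub by blast
    have "low (?V \<union> p ` {1..k}) r \<Longrightarrow> c r \<noteq> 0" using c(2) low_mono[of U r ?V] unfolding eq by blast
    from ear_colouring[OF ear c(1) this rV] show ?thesis unfolding eq .
  qed
qed

end

section \<open>From good colourings to packing colourings\<close>

text \<open>The distance is an infimum of numbers of arcs over all walks. Distinct nonadjacent
  vertices have no walk with fewer than two arcs, so the infimum is at least \<open>2\<close>; the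
  bound for distance \<open>2\<close> is obtained in the same way.\<close>

lemma arc_if_graph_dist_le_1:
  assumes "u \<noteq> v" "graph_dist G u v \<le> 1" "pair_wf_digraph G"
  shows "(u, v) \<in> parcs G"
proof (rule ccontr)
  interpret pair_wf_digraph G by fact
  assume non_adjacent: "(u, v) \<notin> parcs G"
  have "2 \<le> graph_dist G u v"
    unfolding graph_dist_def \<mu>_def
  proof (rule INF_greatest)
    fix p assume "p \<in> {p. awalk u p v}"
    then have "awalk u p v" by simp
    then have "2 \<le> length p"
      using assms(1) non_adjacent
      by (cases p; cases "tl p") (auto simp: awalk_simps)
    then show "2 \<le> ereal (awalk_cost (\<lambda>_. 1) p)"
      by (simp add: awalk_cost_def sum_list_triv)
  qed
  then have "(2 :: ereal) \<le> 1" using assms(2) by (rule order_trans)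
  then show False by simp
qed

lemma common_neighbour_if_graph_dist_le_2:
  assumes "u \<noteq> v" "graph_dist G u v \<le> 2" "pair_wf_digraph G"
  shows "(u, v) \<in> parcs G \<or> (\<exists>w. (u, w) \<in> parcs G \<and> (w, v) \<in> parcs G)"
proof (rule ccontr)
  interpret pair_wf_digraph G by fact
  assume far: "\<not> ((u, v) \<in> parcs G \<or> (\<exists>w. (u, w) \<in> parcs G \<and> (w, v) \<in> parcs G))"
  have "3 \<le> graph_dist G u v"
    unfolding graph_dist_def \<mu>_def
  proof (rule INF_greatest)
    fix p assume "p \<in> {p. awalk u p v}"
    then have "awalk u p v" by simp
    then have "3 \<le> length p"
      using assms(1) far
      by (cases p; cases "tl p"; cases "tl (tl p)") (auto simp: awalk_simps)
    then show "3 \<le> ereal (awalk_cost (\<lambda>_. 1) p)"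
      by (simp add: awalk_cost_def sum_list_triv)
  qed
  then have "(3 :: ereal) \<le> 2" using assms(2) by (rule order_trans)
  then show False by simp
qed

lemma cubic_no_theta_parcs:
  assumes "pair_graph G" "subcubic G" "triangle_free G" "\<not> theta_subgraph (\<lambda>u v. (u, v) \<in> parcs G)"
  shows "cubic_no_theta (\<lambda>u v. (u, v) \<in> parcs G)"
proof -
  interpret pair_graph G by fact
  show ?thesis
  proof
    fix u v w
    show "(v, u) \<in> parcs G" if "(u, v) \<in> parcs G"
      using pair_sym_arcs that unfolding symmetric_def by (auto dest: symD)
    show "(u, u) \<notin> parcs G" using pair_no_loops[of "(u, u)"] by auto
    show "(w, u) \<notin> parcs G" if "(u, v) \<in> parcs G" "(v, w) \<in> parcs G"
      using assms(3) that unfolding triangle_free_def by blast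
    have nbrs: "{v. (u, v) \<in> parcs G} = snd ` {e \<in> parcs G. fst e = u}" by force
    have fin: "finite {e \<in> parcs G. fst e = u}" using pair_finite_arcs by simp
    show "finite {v. (u, v) \<in> parcs G}" unfolding nbrs using fin by (rule finite_imageI)
    show "card {v. (u, v) \<in> parcs G} \<le> 3"
    \<comment> \<open>\<open>subcubic\<close> speaks of vertices only; an element outside
      \<open>pverts G\<close> is the tail of no arc.\<close>
    proof (cases "u \<in> pverts G")
      case True
      have "card {v. (u, v) \<in> parcs G} \<le> card {e \<in> parcs G. fst e = u}"
        unfolding nbrs by (rule card_image_le[OF fin])
      also have "\<dots> = out_degree (with_proj G) u" by (simp add: out_degree_def out_arcs_def)
      also have "\<dots> \<le> 3" using assms(2) True unfolding subcubic_def by blast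
      finally show ?thesis .
    next
      case False
      then have "{v. (u, v) \<in> parcs G} = {}" using in_arcsD1 by blast
      then show ?thesis by simp
    qed
  qed (rule assms(4))
qed

lemma packing_colouring_if_good:
  assumes "pair_graph G" and loc: "cubic_no_theta (\<lambda>u v. (u, v) \<in> parcs G)"
    and c: "cubic_no_theta.good (\<lambda>u v. (u, v) \<in> parcs G) (pverts G) c"
  shows "packing_coloring G [1, 2, 2, 2] c"
proof -
  interpret pair_graph G by fact
  interpret cubic_no_theta "\<lambda>u v. (u, v) \<in> parcs G" by fact
  have wf: "pair_wf_digraph G" by unfold_locales
  have zero: "is_packing G 1 {v \<in> pverts G. c v = 0}"
    unfolding is_packing_def
  proof (intro conjI ballI impI)
    fix u v assume uv: "u \<in> {v \<in> pverts G. c v = 0}" "v \<in> {v \<in> pverts G. c v = 0}" "u \<noteq> v"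
    then have "(u, v) \<notin> parcs G" using good_adj[OF c, of u v] by auto
    then show "ereal (real 1) < graph_dist G u v"
      using arc_if_graph_dist_le_1[OF uv(3) _ wf] by (force simp: not_le one_ereal_def)
  qed auto
  have nonzero: "is_packing G 2 {v \<in> pverts G. c v = i}" if "i \<noteq> 0" for i
    unfolding is_packing_def
  proof (intro conjI ballI impI)
    fix u v assume uv: "u \<in> {v \<in> pverts G. c v = i}" "v \<in> {v \<in> pverts G. c v = i}" "u \<noteq> v"
    then have "(u, v) \<notin> parcs G" using good_adj[OF c, of u v] by auto
    moreover have "\<not> ((u, w) \<in> parcs G \<and> (w, v) \<in> parcs G)" for w
      using good_dist2[OF c, of u w v] uv that in_arcsD2 by auto
    ultimately have "\<not> graph_dist G u v \<le> 2"
      using common_neighbour_if_graph_dist_le_2[OF uv(3) _ wf] by blast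
    then show "ereal (real 2) < graph_dist G u v" by (simp add: not_le)
  qed auto
  show ?thesis
    unfolding packing_coloring_def
  proof (intro conjI ballI allI impI)
    show "c v < length [1, 2, 2, 2 :: nat]" if "v \<in> pverts G" for v
      using good_lt_4[OF c that] by simp
    fix i assume "i < length [1, 2, 2, 2 :: nat]"
    then have "i = 0 \<or> [1, 2, 2, 2 :: nat] ! i = 2 \<and> i \<noteq> 0"
      by (auto simp: less_Suc_eq numeral_eq_Suc)
    then show "is_packing G ([1, 2, 2, 2] ! i) {v \<in> pverts G. c v = i}"
      using zero nonzero by auto
  qed
qed

theorem theorem3:
  fixes G :: "'a pair_pre_digraph"
  assumes "pair_graph G"
    and "subcubic G"
    and "outerplanar G"
    and "triangle_free G"
  shows "packing_colorable G [1, 2, 2, 2]"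
proof -
  interpret pair_graph G by fact
  have "\<not> theta_subgraph (\<lambda>u v. (u, v) \<in> parcs G)"
    by (rule outerplanar_no_theta_subgraph[OF assms(3)]) (blast dest: in_arcsD1 in_arcsD2)
  then interpret cubic_no_theta "\<lambda>u v. (u, v) \<in> parcs G"
    by (rule cubic_no_theta_parcs[OF assms(1,2,4)])
  have "\<exists>c. good (pverts G) c"
  proof (cases "pverts G = {}")
    \<comment> \<open>Without vertices there is no root to choose.\<close>
    case True
    then show ?thesis by (simp add: good_def)
  next
    case False
    then show ?thesis using rooted_good_colouring[OF pair_finite_verts] by blast
  qed
  then show ?thesis
    using packing_colouring_if_good[OF assms(1) cubic_no_theta_axioms] unfolding packing_colorable_def by blast
qed

end
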